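(* Let $f:X\to\mathbb{R}$ be Lipschitz. Then for every cylinder $k\subset X$, $$\lim\frac1c\log\big(\pi_{c,N}(k)\big)=-\inf_{x\in k\cap\mathrm{PER}}I(x)=-\inf_{x\in k}\widetilde I(x),$$ where the limit is taken as $c\to\infty$, $N\to\infty$ ($c>0$, $N\in\mathbb{N}$) with $\frac{N}{c}\to0$.
   Context: $X=\{1,\dots,d\}^{\mathbb{N}}$ is the full Bernoulli space with shift $\sigma$ and metric $d(x,y)=\theta^{N}$, where $N$ is the first index with $x_N\ne y_N$ (and $d(x,x)=0$), $0<\theta<1$ fixed. Lipschitz is with respect to this metric. A cylinder is a set $\{x\in X: x_1=a_1,\dots,x_m=a_m\}$. For $g:X\to\mathbb{R}$, $g^n(x)=g(x)+g(\sigma x)+\dots+g(\sigma^{n-1}x)$. $\mathrm{Fix}_n=\{x:\sigma^n(x)=x\}$; $\mathrm{PER}=\bigcup_{n\ge1}\mathrm{Fix}_n$; $n_x$ is the minimal period of $x\in\mathrm{PER}$. $P(\cdot)$ is topological pressure for $\sigma$. $\beta(f)=\sup_{\nu}\int f\,d\nu$ over $\sigma$-invariant Borel probabilities $\nu$. For $x\in\mathrm{PER}$, $I(x)=n_x\beta(f)-f^{n_x}(x)$. For $x\in X$, $$\widetilde I(x)=\lim_{\epsilon\to0}\Big(\inf\{I(y): y\in\mathrm{PER},\ d(y,x)\le\epsilon\}\Big)\in[0,\infty].$$ For $c>0$, $N\in\mathbb{N}$, $\pi_{c,N}$ is the $\sigma$-invariant probability with $$\int g\,d\pi_{c,N}=\frac{\sum_{n=1}^{N}\sum_{x\in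 \mathrm{Fix}_{n}}e^{cf^{n}(x)-nP(cf)}\frac{g^{n}(x)}{n}}{\sum_{n=1}^{N}\sum_{x\in \mathrm{Fix}_{n}}e^{cf^{n}(x)-nP(cf)}}$$ for continuous $g$. *)

theory Defs
  imports "HOL-Analysis.Analysis"
begin

text \<open>Sequences are indexed from \<open>0\<close>: the coordinate \<open>x 0\<close> is the first letter \<open>x\<^sub>1\<close>.
  Hence the exponent of the metric is the successor of the first index of disagreement, and
  two points with distinct first letters are at distance \<open>\<theta>\<close>.\<close>

definition bernoulli :: "nat \<Rightarrow> (nat \<Rightarrow> nat) set" where
  "bernoulli d = {x. \<forall>i. x i \<in> {1..d}}"

definition shift :: "(nat \<Rightarrow> nat) \<Rightarrow> (nat \<Rightarrow> nat)" where
  "shift x = (\<lambda>i. x (Suc i))"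

definition bdist :: "real \<Rightarrow> (nat \<Rightarrow> nat) \<Rightarrow> (nat \<Rightarrow> nat) \<Rightarrow> real" where
  "bdist \<theta> x y = (if x = y then 0 else \<theta> ^ Suc (LEAST i. x i \<noteq> y i))"

definition bernoulli_metric :: "nat \<Rightarrow> real \<Rightarrow> (nat \<Rightarrow> nat) metric" where
  "bernoulli_metric d \<theta> = metric (bernoulli d, bdist \<theta>)"

lemma bdist_ultrametric:
  assumes "0 < \<theta>" "\<theta> < 1"
  shows "bdist \<theta> x z \<le> max (bdist \<theta> x y) (bdist \<theta> y z)"
proof (cases "x = y \<or> y = z \<or> x = z")
  case True
  moreover have "0 \<le> bdist \<theta> u v" for u v using assms(1) by (simp add: bdist_def)
  ultimately show ?thesis by (metis bdist_def le_max_iff_disj order_refl)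
next
  case False
  define i j k where "i = (LEAST i. x i \<noteq> z i)" and "j = (LEAST i. x i \<noteq> y i)"
    and "k = (LEAST i. y i \<noteq> z i)"
  have "\<exists>i. x i \<noteq> z i" using False by blast
  then have "x i \<noteq> z i" unfolding i_def by (rule LeastI_ex)
  then have "x i \<noteq> y i \<or> y i \<noteq> z i" by metis
  then have "j \<le> i \<or> k \<le> i" unfolding j_def k_def by (blast intro: Least_le)
  then have "\<theta> ^ Suc i \<le> \<theta> ^ Suc j \<or> \<theta> ^ Suc i \<le> \<theta> ^ Suc k"
    using assms by (meson Suc_le_mono less_imp_le power_decreasing)
  moreover have "bdist \<theta> x z = \<theta> ^ Suc i" "bdist \<theta> x y = \<theta> ^ Suc j" "bdist \<theta> y z = \<theta> ^ Suc k"
    using False unfolding bdist_def i_def j_def k_def by presburger+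
  ultimately show ?thesis by (simp only: le_max_iff_disj)
qed

lemma Metric_space_bernoulli:
  assumes "0 < \<theta>" "\<theta> < 1"
  shows "Metric_space (bernoulli d) (bdist \<theta>)"
proof
  show nn: "0 \<le> bdist \<theta> x y" for x y using assms by (simp add: bdist_def)
  show "bdist \<theta> x y = bdist \<theta> y x" for x y by (simp add: bdist_def eq_commute[of x y] eq_commute[of "x i" "y i" for i])
  show "bdist \<theta> x y = 0 \<longleftrightarrow> x = y" for x y using assms by (simp add: bdist_def)
  show "bdist \<theta> x z \<le> bdist \<theta> x y + bdist \<theta> y z" for x y z
    using bdist_ultrametric[OF assms, of x z y] nn[of x y] nn[of y z] by linarith
qed

lemma bernoulli_metric_simps:
  assumes "0 < \<theta>" "\<theta> < 1"
  shows "mspace (bernoulli_metric d \<theta>) = bernoulli d"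
    and "mdist (bernoulli_metric d \<theta>) = bdist \<theta>"
  using Metric_space_bernoulli[OF assms]
  by (simp_all add: bernoulli_metric_def Metric_space.mspace_metric Metric_space.mdist_metric)

definition cylinder :: "nat \<Rightarrow> nat list \<Rightarrow> (nat \<Rightarrow> nat) set" where
  "cylinder d a = {x \<in> bernoulli d. \<forall>i < length a. x i = a ! i}"

definition cylinders :: "nat \<Rightarrow> (nat \<Rightarrow> nat) set set" where
  "cylinders d = {cylinder d a | a. set a \<subseteq> {1..d}}"

definition birkhoff :: "('a \<Rightarrow> 'a) \<Rightarrow> ('a \<Rightarrow> real) \<Rightarrow> nat \<Rightarrow> 'a \<Rightarrow> real" where
  "birkhoff T g n x = (\<Sum>i<n. g ((T ^^ i) x))"

definition Fix :: "nat \<Rightarrow> nat \<Rightarrow> (nat \<Rightarrow> nat) set" where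
  "Fix d n = {x \<in> bernoulli d. (shift ^^ n) x = x}"

definition PER :: "nat \<Rightarrow> (nat \<Rightarrow> nat) set" where
  "PER d = (\<Union>n\<in>{1..}. Fix d n)"

definition min_period :: "(nat \<Rightarrow> nat) \<Rightarrow> nat" where
  "min_period x = (LEAST n. 1 \<le> n \<and> (shift ^^ n) x = x)"

definition borel_on :: "'a topology \<Rightarrow> 'a measure" where
  "borel_on X = sigma (topspace X) {U. openin X U}"

definition invariant_probs :: "'a topology \<Rightarrow> ('a \<Rightarrow> 'a) \<Rightarrow> 'a measure set" where
  "invariant_probs X T =
     {\<nu>. sets \<nu> = sets (borel_on X) \<and> emeasure \<nu> (space \<nu>) = 1 \<and>
         T \<in> measurable \<nu> \<nu> \<and> distr \<nu> \<nu> T = \<nu>}"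

definition beta :: "nat \<Rightarrow> real \<Rightarrow> ((nat \<Rightarrow> nat) \<Rightarrow> real) \<Rightarrow> real" where
  "beta d \<theta> f =
     (SUP \<nu> \<in> invariant_probs (mtopology_of (bernoulli_metric d \<theta>)) shift. (\<integral>x. f x \<partial>\<nu>))"

text \<open>Topological pressure of a continuous map of a compact metric space, defined through
  \<open>(n,\<epsilon>)\<close>-separated sets. By compactness these sets have bounded cardinality, so the
  finiteness requirement excludes nothing and the real supremum below is that of a bounded
  set.\<close>

definition separated :: "'a metric \<Rightarrow> ('a \<Rightarrow> 'a) \<Rightarrow> nat \<Rightarrow> real \<Rightarrow> 'a set \<Rightarrow> bool" where
  "separated m T n \<epsilon> E \<longleftrightarrow> finite E \<and> E \<subseteq> mspace m \<and>
     (\<forall>x\<in>E. \<forall>y\<in>E. x \<noteq> y \<longrightarrow> (\<exists>i<n. \<epsilon> < mdist m ((T ^^ i) x) ((T ^^ i) y)))"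

definition separated_sum ::
    "'a metric \<Rightarrow> ('a \<Rightarrow> 'a) \<Rightarrow> ('a \<Rightarrow> real) \<Rightarrow> nat \<Rightarrow> real \<Rightarrow> real" where
  "separated_sum m T g n \<epsilon> = (SUP E \<in> {E. separated m T n \<epsilon> E}. \<Sum>x\<in>E. exp (birkhoff T g n x))"

definition pressure :: "'a metric \<Rightarrow> ('a \<Rightarrow> 'a) \<Rightarrow> ('a \<Rightarrow> real) \<Rightarrow> real" where
  "pressure m T g =
     real_of_ereal (Lim (at_right 0)
       (\<lambda>\<epsilon>. limsup (\<lambda>n. ereal (ln (separated_sum m T g n \<epsilon>) / real n))))"

definition dev :: "nat \<Rightarrow> real \<Rightarrow> ((nat \<Rightarrow> nat) \<Rightarrow> real) \<Rightarrow> (nat \<Rightarrow> nat) \<Rightarrow> real" where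
  "dev d \<theta> f x = real (min_period x) * beta d \<theta> f - birkhoff shift f (min_period x) x"

definition dev_lim :: "nat \<Rightarrow> real \<Rightarrow> ((nat \<Rightarrow> nat) \<Rightarrow> real) \<Rightarrow> (nat \<Rightarrow> nat) \<Rightarrow> ereal" where
  "dev_lim d \<theta> f x =
     Lim (at_right 0) (\<lambda>\<epsilon>. INF y \<in> {y \<in> PER d. bdist \<theta> y x \<le> \<epsilon>}. ereal (dev d \<theta> f y))"

definition weight ::
    "nat \<Rightarrow> real \<Rightarrow> ((nat \<Rightarrow> nat) \<Rightarrow> real) \<Rightarrow> real \<Rightarrow> nat \<Rightarrow> (nat \<Rightarrow> nat) \<Rightarrow> real" where
  "weight d \<theta> f c n x =
     exp (c * birkhoff shift f n x
          - real n * pressure (bernoulli_metric d \<theta>) shift (\<lambda>y. c * f y))"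

definition periodic_measure ::
    "nat \<Rightarrow> real \<Rightarrow> ((nat \<Rightarrow> nat) \<Rightarrow> real) \<Rightarrow> real \<Rightarrow> nat \<Rightarrow> (nat \<Rightarrow> nat) measure" where
  "periodic_measure d \<theta> f c N =
     (THE \<mu>. \<mu> \<in> invariant_probs (mtopology_of (bernoulli_metric d \<theta>)) shift \<and>
        (\<forall>g. continuous_map (mtopology_of (bernoulli_metric d \<theta>)) euclideanreal g \<longrightarrow>
           (\<integral>x. g x \<partial>\<mu>) =
             (\<Sum>n=1..N. \<Sum>x\<in>Fix d n. weight d \<theta> f c n x * (birkhoff shift g n x / real n)) /
             (\<Sum>n=1..N. \<Sum>x\<in>Fix d n. weight d \<theta> f c n x)))"

end

theory Submission
  imports Defs
begin

text \<open>Write \<open>P\<close> for the pressure of \<open>c f\<close>, \<open>\<beta>\<close> for \<open>beta d \<theta> f\<close> and \<open>f\<^sup>n\<close> for Birkhoff sums. Since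
  \<open>c \<beta> \<le> P \<le> c \<beta> + ln d\<close>, the weight of a point \<open>x\<close> with period \<open>n \<le> N\<close> is
  \<open>exp (- c (n \<beta> - f\<^sup>n x))\<close> up to a factor between \<open>d\<^sup>-\<^sup>N\<close> and \<open>1\<close>, and there are at most \<open>N d\<^sup>N\<close> such points.
  All these factors vanish on the scale \<open>1/c\<close> when \<open>N/c\<close> tends to \<open>0\<close>, so only the smallest value
  of \<open>n \<beta> - f\<^sup>n x\<close> over the periodic points of the cylinder survives, provided that the total mass
  does not decay, that is, that periodic orbits have losses \<open>n \<beta> - f\<^sup>n x\<close> arbitrarily close to \<open>0\<close>.
  The latter is shown without sub-actions: some orbit segments of every length \<open>n\<close> have
  Birkhoff sum close to \<open>n \<beta>\<close> or more, and if every loop lost a definite amount, then cutting out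
  almost closed loops would contradict the bound \<open>f\<^sup>n x \<le> n \<beta> + K\<close>.\<close>

subsection \<open>Birkhoff sums and periodic points\<close>

lemma birkhoff_0 [simp]: "birkhoff T g 0 x = 0"
  by (simp add: birkhoff_def)

lemma birkhoff_Suc: "birkhoff T g (Suc n) x = g x + birkhoff T g n (T x)"
  unfolding birkhoff_def by (subst sum.lessThan_Suc_shift) (simp add: funpow_swap1)

lemma birkhoff_add: "birkhoff T g (m + n) x = birkhoff T g m x + birkhoff T g n ((T ^^ m) x)"
  by (induction m arbitrary: x) (simp_all add: birkhoff_Suc funpow_swap1)

lemma birkhoff_mult_left: "birkhoff T (\<lambda>y. c * g y) n x = c * birkhoff T g n x"
  by (simp add: birkhoff_def sum_distrib_left)

lemma birkhoff_periodic:
  assumes "(T ^^ n) x = x"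
  shows "birkhoff T g n (T x) = birkhoff T g n x"
proof -
  have "g x + birkhoff T g n (T x) = birkhoff T g n x + g ((T ^^ n) x)"
    unfolding birkhoff_Suc[symmetric] by (simp add: birkhoff_def)
  then show ?thesis by (simp add: assms)
qed

lemma funpow_shift: "(shift ^^ n) x i = x (i + n)"
  by (induction n arbitrary: x) (simp_all add: shift_def funpow_Suc_right del: funpow.simps(2))

lemma shift_bernoulli: "x \<in> bernoulli d \<Longrightarrow> shift x \<in> bernoulli d"
  by (simp add: bernoulli_def shift_def)

lemma funpow_shift_bernoulli: "x \<in> bernoulli d \<Longrightarrow> (shift ^^ n) x \<in> bernoulli d"
  by (simp add: bernoulli_def funpow_shift)

lemma shift_Fix: "x \<in> Fix d n \<Longrightarrow> shift x \<in> Fix d n"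
  by (auto simp: Fix_def shift_bernoulli) (metis funpow_swap1)

lemma funpow_shift_Fix: "x \<in> Fix d n \<Longrightarrow> (shift ^^ m) x \<in> Fix d n"
  by (induction m) (simp_all add: shift_Fix)

lemma Fix_bernoulli: "x \<in> Fix d n \<Longrightarrow> x \<in> bernoulli d"
  by (simp add: Fix_def)

text \<open>The shift permutes \<open>Fix d n\<close>; its inverse there is
  \<open>shift ^^ (n - 1)\<close>.\<close>

lemma sum_Fix_shift: "(\<Sum>x\<in>Fix d n. g (shift x)) = (\<Sum>x\<in>Fix d n. g x :: real)" if "1 \<le> n"
proof (rule sum.reindex_bij_witness[where j = shift and i = "shift ^^ (n - 1)"])
  have *: "(shift ^^ (n - 1)) (shift x) = x" "shift ((shift ^^ (n - 1)) x) = x" if "x \<in> Fix d n" for x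
    using that \<open>1 \<le> n\<close> unfolding Fix_def
    by (cases n; simp add: funpow_swap1)+
  show "(shift ^^ (n - 1)) (shift x) = x" "shift ((shift ^^ (n - 1)) x) = x" if "x \<in> Fix d n" for x
    using * that by blast+
  show "(shift ^^ (n - 1)) x \<in> Fix d n" if "x \<in> Fix d n" for x
    using that by (rule funpow_shift_Fix)
qed (auto simp: shift_Fix)

text \<open>Under shift-invariant weights every term of the orbit average contributes the same sum,
  so \<open>g\<close> may stand for its average. This turns the integrals defining
  \<open>periodic_measure\<close> into weighted sums of point values.\<close>

lemma sum_Fix_birkhoff:
  assumes "1 \<le> n" and w: "\<And>x. x \<in> Fix d n \<Longrightarrow> w (shift x) = w x"
  shows "(\<Sum>x\<in>Fix d n. w x * (birkhoff shift g n x / real n)) = (\<Sum>x\<in>Fix d n. w x * g x)"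
proof -
  have step: "(\<Sum>x\<in>Fix d n. w x * g ((shift ^^ i) x)) = (\<Sum>x\<in>Fix d n. w x * g x)" for i
  proof (induction i)
    case (Suc i)
    have "(\<Sum>x\<in>Fix d n. w x * g ((shift ^^ Suc i) x)) =
        (\<Sum>x\<in>Fix d n. w (shift x) * g ((shift ^^ i) (shift x)))"
      by (rule sum.cong) (simp_all add: w funpow_swap1)
    also have "\<dots> = (\<Sum>x\<in>Fix d n. w x * g ((shift ^^ i) x))"
      by (rule sum_Fix_shift[OF assms(1)])
    finally show ?case using Suc.IH by simp
  qed simp
  have "(\<Sum>x\<in>Fix d n. w x * (birkhoff shift g n x / real n)) =
      (\<Sum>x\<in>Fix d n. \<Sum>i<n. w x * g ((shift ^^ i) x)) / real n"
    by (simp add: birkhoff_def sum_distrib_left sum_divide_distrib)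
  also have "(\<Sum>x\<in>Fix d n. \<Sum>i<n. w x * g ((shift ^^ i) x)) = real n * (\<Sum>x\<in>Fix d n. w x * g x)"
    by (subst sum.swap) (simp add: step)
  finally show ?thesis using assms(1) by simp
qed

text \<open>Points told apart by their first \<open>n\<close> letters inject into the words of
  length \<open>n\<close>. Serves both for periodic points and for separated sets.\<close>

lemma words_card:
  assumes "\<And>x. x \<in> A \<Longrightarrow> x \<in> bernoulli d"
    and "\<And>x y. x \<in> A \<Longrightarrow> y \<in> A \<Longrightarrow> (\<forall>i<n. x i = y i) \<Longrightarrow> x = y"
  shows "finite A" "card A \<le> d ^ n"
proof -
  let ?r = "\<lambda>x. restrict x {..<n}"
  have inj: "inj_on ?r A"
    using assms(2) by (auto simp: inj_on_def restrict_def fun_eq_iff)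
  have im: "?r ` A \<subseteq> ({..<n} \<rightarrow>\<^sub>E {1..d})"
    using assms(1) by (simp add: bernoulli_def image_subset_iff restrict_PiE_iff)
  have fin: "finite ({..<n} \<rightarrow>\<^sub>E {1..d})" by (simp add: finite_PiE)
  show "finite A" using inj im fin finite_imageD finite_subset by blast
  have "card A \<le> card ({..<n} \<rightarrow>\<^sub>E {1..d})" using card_inj_on_le[OF inj im fin] .
  then show "card A \<le> d ^ n" by (simp add: card_PiE)
qed

section \<open>Periodic points: counting, periodization, minimal period\<close>

lemma Fix_mod:
  assumes "x \<in> Fix d n"
  shows "x i = x (i mod n)"
proof -
  have "x (j + n) = x j" for j
    using assms funpow_shift[of n x j] by (simp add: Fix_def)
  then have "x (j + m * n) = x j" for j m
    by (induction m) (simp_all, metis add.assoc add.commute)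
  from this[of "i mod n" "i div n"] show ?thesis by simp
qed

lemma Fix_eqI:
  assumes "x \<in> Fix d n" "y \<in> Fix d n" "1 \<le> n" "\<forall>i<n. x i = y i"
  shows "x = y"
proof
  fix i show "x i = y i"
    using assms Fix_mod[of x d n i] Fix_mod[of y d n i] by simp
qed

lemma finite_Fix: "1 \<le> n \<Longrightarrow> finite (Fix d n)"
  and card_Fix: "1 \<le> n \<Longrightarrow> card (Fix d n) \<le> d ^ n"
  using words_card[of "Fix d n" d n] Fix_eqI Fix_bernoulli by blast+

text \<open>The periodic point that repeats the first \<open>n\<close> letters of \<open>x\<close>.
  For \<open>n = 0\<close> it is \<open>x\<close> itself, because \<open>i mod 0 = i\<close>; this
  fits \<open>Fix d 0\<close> being the whole space.\<close>

definition periodize :: "nat \<Rightarrow> (nat \<Rightarrow> nat) \<Rightarrow> nat \<Rightarrow> nat" where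
  "periodize n x = (\<lambda>i. x (i mod n))"

lemma periodize_Fix: "x \<in> bernoulli d \<Longrightarrow> periodize n x \<in> Fix d n"
  by (simp add: Fix_def bernoulli_def periodize_def fun_eq_iff funpow_shift)

lemma min_period:
  assumes "x \<in> PER d"
  shows "1 \<le> min_period x" "x \<in> Fix d (min_period x)"
proof -
  have "\<exists>n. 1 \<le> n \<and> (shift ^^ n) x = x" using assms by (auto simp: PER_def Fix_def)
  from LeastI_ex[OF this] show "1 \<le> min_period x" "x \<in> Fix d (min_period x)"
    using assms by (auto simp: PER_def Fix_def min_period_def)
qed

lemma min_period_le: "1 \<le> n \<Longrightarrow> x \<in> Fix d n \<Longrightarrow> min_period x \<le> n"
  by (auto simp: min_period_def Fix_def intro: Least_le)

section \<open>Distance and common prefixes\<close>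

lemma bdist_self [simp]: "bdist \<theta> x x = 0"
  by (simp add: bdist_def)

text \<open>The exponent of the metric is the first index of disagreement plus one, so a
  disagreement before index \<open>m\<close> already forces a distance of at least
  \<open>\<theta> ^ m\<close>.\<close>

lemma bdist_less_agree:
  assumes "0 < \<theta>" "\<theta> < 1" "bdist \<theta> x y < \<theta> ^ m" "i < m"
  shows "x i = y i"
proof (rule ccontr)
  assume ne: "x i \<noteq> y i"
  let ?l = "LEAST i. x i \<noteq> y i"
  have "?l \<le> i" using ne by (rule Least_le)
  then have "\<theta> ^ m \<le> \<theta> ^ Suc ?l" using assms by (intro power_decreasing) auto
  moreover have "bdist \<theta> x y = \<theta> ^ Suc ?l" using ne by (auto simp: bdist_def)
  ultimately show False using assms(3) by simp
qed

lemma bdist_le_of_agree: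
  assumes "0 < \<theta>" "\<theta> < 1" "\<forall>i<m. x i = y i"
  shows "bdist \<theta> x y \<le> \<theta> ^ Suc m"
proof (cases "x = y")
  case False
  then have "\<exists>i. x i \<noteq> y i" by blast
  then have "x (LEAST i. x i \<noteq> y i) \<noteq> y (LEAST i. x i \<noteq> y i)" by (rule LeastI_ex)
  then have "m \<le> (LEAST i. x i \<noteq> y i)" using assms(3) not_le by blast
  then show ?thesis using False assms unfolding bdist_def
    by (simp only: if_False) (intro power_decreasing, auto)
qed (use assms in \<open>simp add: bdist_def\<close>)

subsection \<open>Cylinders and invariant measures\<close>

lemma Int_stable_cylinders: "Int_stable (range (cylinder d))"
proof (rule Int_stableI)
  fix A B assume "A \<in> range (cylinder d)" "B \<in> range (cylinder d)"
  then obtain a b where ab: "A = cylinder d a" "B = cylinder d b" by blast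
  have *: "cylinder d a \<inter> cylinder d b \<in> range (cylinder d)" if "length a \<le> length b" for a b
  proof (cases "\<forall>i<length a. a ! i = b ! i")
    case True
    then have "cylinder d a \<inter> cylinder d b = cylinder d b"
      using that by (auto simp: cylinder_def)
    then show ?thesis by simp
  next
    case False
    then obtain i where i: "i < length a" "a ! i \<noteq> b ! i" by blast
    then have "i < length b" using that by simp
    with i have "cylinder d a \<inter> cylinder d b = {}" by (auto simp: cylinder_def)
    \<comment> \<open>The letter \<open>0\<close> does not occur in the alphabet, so this cylinder
      is empty.\<close>
    also have "\<dots> = cylinder d [0]"
      by (auto simp: cylinder_def bernoulli_def intro!: exI[of _ 0])
    finally show ?thesis by simp
  qed
  show "A \<inter> B \<in> range (cylinder d)"
    unfolding ab
  proof (cases "length a \<le> length b")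
    case True
    then show "cylinder d a \<inter> cylinder d b \<in> range (cylinder d)" by (rule *)
  next
    case False
    then show "cylinder d a \<inter> cylinder d b \<in> range (cylinder d)"
      by (subst Int_commute) (rule *, simp)
  qed
qed

lemma cylinder_subset: "cylinder d a \<subseteq> bernoulli d"
  by (auto simp: cylinder_def)

lemma cylinder_Nil [simp]: "cylinder d [] = bernoulli d"
  by (simp add: cylinder_def)

locale bernoulli_shift =
  fixes d :: nat and \<theta> :: real
  assumes d_pos: "1 \<le> d" and theta: "0 < \<theta>" "\<theta> < 1"
begin

abbreviation "\<X> \<equiv> mtopology_of (bernoulli_metric d \<theta>)"

lemma mspace_X [simp]: "mspace (bernoulli_metric d \<theta>) = bernoulli d"
  by (rule bernoulli_metric_simps[OF theta])

lemma topspace_X: "topspace \<X> = bernoulli d"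
  by simp

text \<open>Small balls and prefix classes refine each other, so the topology can be handled through
  prefixes alone, without \<open>\<theta>\<close>.\<close>

lemma openin_X:
  "openin \<X> U \<longleftrightarrow> U \<subseteq> bernoulli d \<and>
    (\<forall>x\<in>U. \<exists>m. \<forall>y\<in>bernoulli d. (\<forall>i<m. x i = y i) \<longrightarrow> y \<in> U)" (is "_ \<longleftrightarrow> ?R")
proof -
  interpret M: Metric_space "bernoulli d" "bdist \<theta>" by (rule Metric_space_bernoulli[OF theta])
  have eq: "\<X> = M.mtopology" by (simp add: mtopology_of_def bernoulli_metric_simps[OF theta])
  show ?thesis unfolding eq M.openin_mtopology
  proof (intro conj_cong refl iffI ballI allI impI)
    fix x assume U: "U \<subseteq> bernoulli d" and "\<forall>x. x \<in> U \<longrightarrow> (\<exists>r>0. M.mball x r \<subseteq> U)" and x: "x \<in> U"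
    then obtain r where r: "r > 0" "M.mball x r \<subseteq> U" by blast
    from real_arch_pow_inv[OF r(1) theta(2)] obtain m where m: "\<theta> ^ m < r" by blast
    show "\<exists>m. \<forall>y\<in>bernoulli d. (\<forall>i<m. x i = y i) \<longrightarrow> y \<in> U"
    proof (intro exI ballI impI)
      fix y assume y: "y \<in> bernoulli d" and "\<forall>i<m. x i = y i"
      then have "bdist \<theta> x y \<le> \<theta> ^ Suc m" using bdist_le_of_agree[OF theta] by blast
      also have "\<dots> \<le> \<theta> ^ m" using theta by (intro power_decreasing) auto
      finally have "bdist \<theta> x y < r" using m by simp
      then show "y \<in> U" using r(2) U x y by (auto simp: M.mball_def)
    qed
  next
    fix x assume U: "U \<subseteq> bernoulli d" and x: "x \<in> U"
      and "\<forall>x\<in>U. \<exists>m. \<forall>y\<in>bernoulli d. (\<forall>i<m. x i = y i) \<longrightarrow> y \<in> U"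
    then obtain m where m: "\<forall>y\<in>bernoulli d. (\<forall>i<m. x i = y i) \<longrightarrow> y \<in> U" by blast
    have "M.mball x (\<theta> ^ m) \<subseteq> U"
      using m bdist_less_agree[OF theta] by (auto simp: M.mball_def)
    then show "\<exists>r>0. M.mball x r \<subseteq> U" using theta by (intro exI[of _ "\<theta> ^ m"]) simp
  qed
qed

lemma openin_cylinder: "openin \<X> (cylinder d a)"
  unfolding openin_X by (auto simp: cylinder_def intro!: exI[of _ "length a"])

lemma continuous_map_XI:
  assumes "\<And>x e. x \<in> bernoulli d \<Longrightarrow> 0 < e \<Longrightarrow>
    \<exists>m. \<forall>y\<in>bernoulli d. (\<forall>i<m. x i = y i) \<longrightarrow> \<bar>g y - g x\<bar> < e"
  shows "continuous_map \<X> euclideanreal g"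
  unfolding continuous_map_def topspace_X
proof (intro conjI allI impI)
  fix U :: "real set" assume "openin euclideanreal U"
  then have U: "open U" by simp
  show "openin \<X> {x \<in> bernoulli d. g x \<in> U}"
    unfolding openin_X
  proof (intro conjI ballI)
    fix x assume "x \<in> {x \<in> bernoulli d. g x \<in> U}"
    then have x: "x \<in> bernoulli d" "g x \<in> U" by auto
    with U obtain e where e: "e > 0" "\<forall>z. dist z (g x) < e \<longrightarrow> z \<in> U"
      unfolding open_dist by blast
    from assms[OF x(1) e(1)] obtain m
      where m: "\<forall>y\<in>bernoulli d. (\<forall>i<m. x i = y i) \<longrightarrow> \<bar>g y - g x\<bar> < e" by blast
    show "\<exists>m. \<forall>y\<in>bernoulli d. (\<forall>i<m. x i = y i) \<longrightarrow> y \<in> {x \<in> bernoulli d. g x \<in> U}"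
      using m e(2) by (intro exI[of _ m]) (auto simp: dist_real_def)
  qed auto
qed auto

text \<open>Cylinders are clopen. Hence the integrals of continuous functions, which are all that
  characterizes \<open>periodic_measure\<close>, determine its values on cylinders.\<close>

lemma continuous_map_indicator_cylinder:
  "continuous_map \<X> euclideanreal (indicat_real (cylinder d a))"
  by (rule continuous_map_XI, rule exI[of _ "length a"]) (auto simp: cylinder_def indicator_def)

section \<open>Borel sets and finitely supported invariant measures\<close>

lemma space_borel: "space (borel_on \<X>) = bernoulli d"
  by (simp add: borel_on_def topspace_X space_measure_of_conv)

lemma open_subset_Pow: "{U. openin \<X> U} \<subseteq> Pow (bernoulli d)"
  using openin_subset[of \<X>] by (auto simp: topspace_X)

lemma sets_borel_open: "sets (borel_on \<X>) = sigma_sets (bernoulli d) {U. openin \<X> U}"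
  using open_subset_Pow by (simp add: borel_on_def topspace_X)

text \<open>An open set is the union of the cylinders contained in it, and there are only countably
  many words.\<close>

lemma sets_borel: "sets (borel_on \<X>) = sigma_sets (bernoulli d) (range (cylinder d))"
  unfolding sets_borel_open
proof (rule sigma_sets_eqI)
  fix U assume "U \<in> {U. openin \<X> U}"
  then have U: "openin \<X> U" by simp
  let ?A = "{a. cylinder d a \<subseteq> U}"
  have "U = (\<Union>a\<in>?A. cylinder d a)"
  proof (intro equalityI subsetI)
    fix x assume x: "x \<in> U"
    with U obtain m where m: "\<forall>y\<in>bernoulli d. (\<forall>i<m. x i = y i) \<longrightarrow> y \<in> U"
      unfolding openin_X by blast
    have "cylinder d (map x [0..<m]) \<subseteq> U" using m by (auto simp: cylinder_def)
    moreover have "x \<in> cylinder d (map x [0..<m])"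
      using x U by (auto simp: cylinder_def openin_X)
    ultimately show "x \<in> (\<Union>a\<in>?A. cylinder d a)" by blast
  qed auto
  moreover have "(\<Union>a\<in>?A. cylinder d a) \<in> sigma_sets (bernoulli d) (range (cylinder d))"
    by (rule sigma_sets_UNION) (auto intro: countableI_type countable_image countable_subset)
  ultimately show "U \<in> sigma_sets (bernoulli d) (range (cylinder d))" by simp
qed (auto simp: openin_cylinder)

lemma borel_measurable_continuous_map:
  assumes "continuous_map \<X> euclideanreal g"
  shows "g \<in> borel_measurable (borel_on \<X>)"
proof (rule borel_measurableI)
  fix S :: "real set" assume "open S"
  then have "openin \<X> {x \<in> topspace \<X>. g x \<in> S}"
    using assms by (simp add: continuous_map_def)
  moreover have "{x \<in> topspace \<X>. g x \<in> S} = g -` S \<inter> space (borel_on \<X>)"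
    by (auto simp: topspace_X space_borel)
  ultimately show "g -` S \<inter> space (borel_on \<X>) \<in> sets (borel_on \<X>)"
    unfolding sets_borel_open by (auto intro: sigma_sets.Basic)
qed

lemma shift_measurable: "shift \<in> measurable (borel_on \<X>) (borel_on \<X>)"
proof -
  have "shift \<in> measurable (borel_on \<X>) (sigma (bernoulli d) (range (cylinder d)))"
  proof (rule measurable_measure_of)
    show "range (cylinder d) \<subseteq> Pow (bernoulli d)" by (auto simp: cylinder_def)
    show "shift \<in> space (borel_on \<X>) \<rightarrow> bernoulli d" by (auto simp: space_borel shift_bernoulli)
    fix A assume "A \<in> range (cylinder d)"
    then obtain a where a: "A = cylinder d a" by blast
    \<comment> \<open>The preimage leaves the first letter free; values of \<open>l\<close> outside
      the alphabet contribute empty cylinders.\<close>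
    have "shift -` A \<inter> space (borel_on \<X>) = (\<Union>l\<in>UNIV. cylinder d (l # a))"
      by (auto simp: a space_borel cylinder_def shift_bernoulli shift_def nth_Cons bernoulli_def
          split: nat.splits)
    also have "\<dots> \<in> sets (borel_on \<X>)"
      by (intro sets.countable_UN) (auto simp: sets_borel)
    finally show "shift -` A \<inter> space (borel_on \<X>) \<in> sets (borel_on \<X>)" .
  qed
  moreover have "sets (sigma (bernoulli d) (range (cylinder d))) = sets (borel_on \<X>)"
    using cylinder_subset by (simp add: sets_borel image_subset_iff)
  ultimately show ?thesis by (metis measurable_cong_sets)
qed

text \<open>Indicators of cylinders are continuous, and cylinders form an intersection-stable
  generator. This gives the uniqueness behind the definite description in
  \<open>periodic_measure\<close>, and also reduces invariance to a test on continuous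
  functions.\<close>

lemma measure_eqI_continuous:
  assumes \<mu>: "sets \<mu> = sets (borel_on \<X>)" "emeasure \<mu> (space \<mu>) = 1"
    and \<nu>: "sets \<nu> = sets (borel_on \<X>)" "emeasure \<nu> (space \<nu>) = 1"
    and eq: "\<And>g. continuous_map \<X> euclideanreal g \<Longrightarrow> (\<integral>x. g x \<partial>\<mu>) = (\<integral>x. g x \<partial>\<nu>)"
  shows "\<mu> = \<nu>"
proof -
  interpret \<mu>: finite_measure \<mu> by (rule finite_measureI) (simp add: \<mu>)
  interpret \<nu>: finite_measure \<nu> by (rule finite_measureI) (simp add: \<nu>)
  have sp: "space \<mu> = bernoulli d" "space \<nu> = bernoulli d"
    using \<mu> \<nu> space_borel by (metis sets_eq_imp_space_eq)+
  show ?thesis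
  proof (rule measure_eqI_generator_eq[OF Int_stable_cylinders,
        where \<Omega> = "bernoulli d" and A = "\<lambda>_. bernoulli d"])
    show "range (cylinder d) \<subseteq> Pow (bernoulli d)" by (auto simp: cylinder_def)
    fix A assume "A \<in> range (cylinder d)"
    then obtain a where a: "A = cylinder d a" by blast
    have "A \<inter> bernoulli d = A" using a by (auto simp: cylinder_def)
    then have "measure \<mu> A = measure \<nu> A"
      using eq[OF continuous_map_indicator_cylinder[of a]] by (simp add: a[symmetric] sp)
    then show "emeasure \<mu> A = emeasure \<nu> A"
      by (simp add: \<mu>.emeasure_eq_measure \<nu>.emeasure_eq_measure)
  next
    have "bernoulli d \<in> range (cylinder d)" using cylinder_Nil by (metis rangeI)
    then show "range (\<lambda>_. bernoulli d) \<subseteq> range (cylinder d)" by blast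
  qed (simp_all add: \<mu>(1) \<nu>(1) sets_borel)
qed

text \<open>The atoms are indexed by \<open>A\<close> through \<open>h\<close> instead of being a
  set of points, since one point may occur repeatedly: along an orbit followed over a non-minimal
  period, or as a member of \<open>Fix d n\<close> for several \<open>n\<close>.\<close>

lemma finitely_supported_invariant:
  fixes A :: "'a set" and w :: "'a \<Rightarrow> real" and h :: "'a \<Rightarrow> nat \<Rightarrow> nat"
  assumes A: "finite A" "\<And>a. a \<in> A \<Longrightarrow> 0 \<le> w a" "\<And>a. a \<in> A \<Longrightarrow> h a \<in> bernoulli d"
    and sum1: "(\<Sum>a\<in>A. w a) = 1"
    and inv: "\<And>g. (\<Sum>a\<in>A. w a * g (shift (h a))) = (\<Sum>a\<in>A. w a * g (h a) :: real)"
  obtains \<mu> where "\<mu> \<in> invariant_probs \<X> shift"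
    and "\<And>g. continuous_map \<X> euclideanreal g \<Longrightarrow> (\<integral>x. g x \<partial>\<mu>) = (\<Sum>a\<in>A. w a * g (h a))"
proof
  define \<mu> where "\<mu> = distr (point_measure A w) (borel_on \<X>) h"
  have h: "h \<in> measurable (point_measure A w) (borel_on \<X>)"
    using A(3) by (auto simp: measurable_def space_point_measure sets_point_measure space_borel)
  have sets: "sets \<mu> = sets (borel_on \<X>)" by (simp add: \<mu>_def)
  have space: "space \<mu> = bernoulli d" by (simp add: \<mu>_def space_borel)
  have shift: "shift \<in> measurable \<mu> \<mu>"
    using shift_measurable by (simp add: measurable_cong_sets[OF sets sets])
  have one: "emeasure \<mu> (space \<mu>) = 1"
  proof -
    have "emeasure \<mu> (space \<mu>) = emeasure (point_measure A w) (h -` bernoulli d \<inter> A)"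
      using emeasure_distr[OF h, of "bernoulli d"] sets.top[of "borel_on \<X>"]
      unfolding \<mu>_def[symmetric] by (simp add: space space_borel space_point_measure)
    also have "h -` bernoulli d \<inter> A = A" using A(3) by auto
    also have "emeasure (point_measure A w) A = (\<Sum>a\<in>A. ennreal (w a))"
      by (rule emeasure_point_measure_finite) (use A in auto)
    also have "\<dots> = 1" using A(2) sum1 by (simp add: sum_ennreal)
    finally show ?thesis .
  qed
  have int: "(\<integral>x. g x \<partial>\<mu>) = (\<Sum>a\<in>A. w a * g (h a))" if "g \<in> borel_measurable (borel_on \<X>)" for g :: "_ \<Rightarrow> real"
    unfolding \<mu>_def integral_distr[OF h that]
    using A by (simp add: lebesgue_integral_point_measure_finite)
  then show "(\<integral>x. g x \<partial>\<mu>) = (\<Sum>a\<in>A. w a * g (h a))" if "continuous_map \<X> euclideanreal g" for g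
    using that borel_measurable_continuous_map by blast
  have "distr \<mu> \<mu> shift = \<mu>"
  proof (rule measure_eqI_continuous)
    show "emeasure (distr \<mu> \<mu> shift) (space (distr \<mu> \<mu> shift)) = 1"
    proof -
      have "shift -` space \<mu> \<inter> space \<mu> = space \<mu>" using measurable_space[OF shift] by auto
      then show ?thesis using one by (simp add: emeasure_distr[OF shift sets.top])
    qed
    fix g assume "continuous_map \<X> euclideanreal g"
    then have g: "g \<in> borel_measurable (borel_on \<X>)" by (rule borel_measurable_continuous_map)
    then have g': "g \<in> borel_measurable \<mu>" by (simp add: measurable_cong_sets[OF sets refl])
    have "(\<integral>x. g x \<partial>distr \<mu> \<mu> shift) = (\<integral>x. g (shift x) \<partial>\<mu>)"
      by (rule integral_distr[OF shift g'])
    also have "\<dots> = (\<Sum>a\<in>A. w a * g (shift (h a)))"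
      by (rule int) (use shift_measurable g in measurable)
    also have "\<dots> = (\<integral>x. g x \<partial>\<mu>)" by (simp add: int[OF g] inv)
    finally show "(\<integral>x. g x \<partial>distr \<mu> \<mu> shift) = (\<integral>x. g x \<partial>\<mu>)" .
  qed (simp_all add: sets one)
  then show "\<mu> \<in> invariant_probs \<X> shift"
    by (simp add: invariant_probs_def sets one shift)
qed

end

subsection \<open>Birkhoff sums of a Lipschitz potential\<close>

locale lipschitz_potential = bernoulli_shift +
  fixes f :: "(nat \<Rightarrow> nat) \<Rightarrow> real" and B :: real
  assumes B_nonneg: "0 \<le> B"
    and lipschitz: "\<And>x y. x \<in> bernoulli d \<Longrightarrow> y \<in> bernoulli d \<Longrightarrow> \<bar>f x - f y\<bar> \<le> B * bdist \<theta> x y"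
begin

text \<open>The sum of the geometric series with first term \<open>B\<close> and ratio
  \<open>\<theta>\<close>; it bounds the distortion of Birkhoff sums of any length.\<close>

definition "K = B / (1 - \<theta>)"

abbreviation "\<beta> \<equiv> beta d \<theta> f"

lemma K_nonneg: "0 \<le> K"
  using B_nonneg theta by (simp add: K_def)

lemma agree_diff:
  assumes "x \<in> bernoulli d" "y \<in> bernoulli d" "\<forall>i<m. x i = y i"
  shows "\<bar>f x - f y\<bar> \<le> B * \<theta> ^ Suc m"
  using lipschitz[OF assms(1,2)] mult_left_mono[OF bdist_le_of_agree[OF theta assms(3)] B_nonneg]
  by linarith

text \<open>The points reached after \<open>j\<close> steps still share \<open>n + L - j\<close>
  letters, so the termwise differences are dominated by a geometric series that ends at scale
  \<open>\<theta> ^ L\<close>.\<close>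

lemma birkhoff_distortion:
  assumes "x \<in> bernoulli d" "y \<in> bernoulli d" "\<forall>i<n + L. x i = y i"
  shows "\<bar>birkhoff shift f n x - birkhoff shift f n y\<bar> \<le> K * \<theta> ^ L"
proof -
  \<comment> \<open>The factor \<open>1 - \<theta> ^ n\<close> leaves exactly the room
    \<open>K * (1 - \<theta>) * \<theta> ^ (n + L)\<close> for the term added in the induction
    step.\<close>
  have "\<bar>birkhoff shift f n x - birkhoff shift f n y\<bar> \<le> K * (1 - \<theta> ^ n) * \<theta> ^ L"
    using assms
  proof (induction n arbitrary: x y)
    case 0
    then show ?case by simp
  next
    case (Suc n)
    have "\<bar>birkhoff shift f n (shift x) - birkhoff shift f n (shift y)\<bar> \<le> K * (1 - \<theta> ^ n) * \<theta> ^ L"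
      using Suc.prems by (intro Suc.IH shift_bernoulli) (auto simp: shift_def)
    moreover have "\<bar>f x - f y\<bar> \<le> B * \<theta> ^ Suc (Suc n + L)"
      using Suc.prems by (intro agree_diff)
    moreover have "B * \<theta> ^ Suc (Suc n + L) \<le> B * \<theta> ^ (n + L)"
      using B_nonneg theta by (intro mult_left_mono power_decreasing) auto
    moreover have "K * (1 - \<theta>) = B" using theta by (simp add: K_def)
    moreover have "K * (1 - \<theta>) * \<theta> ^ (n + L) + K * (1 - \<theta> ^ n) * \<theta> ^ L = K * (1 - \<theta> ^ Suc n) * \<theta> ^ L"
      by (simp add: power_add algebra_simps)
    ultimately show ?case by (simp add: birkhoff_Suc)
  qed
  also have "\<dots> \<le> K * 1 * \<theta> ^ L"
    using K_nonneg theta by (intro mult_right_mono mult_left_mono) auto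
  finally show ?thesis by simp
qed

lemma f_continuous: "continuous_map \<X> euclideanreal f"
proof (rule continuous_map_XI)
  fix x and e :: real assume x: "x \<in> bernoulli d" and e: "0 < e"
  have "0 < e / (B + 1)" using e B_nonneg by simp
  then obtain m where m: "\<theta> ^ m < e / (B + 1)" using real_arch_pow_inv theta(2) by blast
  have "B * \<theta> ^ Suc m \<le> (B + 1) * \<theta> ^ m"
    using B_nonneg theta by (intro mult_mono power_decreasing) auto
  also have "\<dots> < e" using m B_nonneg by (simp add: field_simps)
  finally show "\<exists>m. \<forall>y\<in>bernoulli d. (\<forall>i<m. x i = y i) \<longrightarrow> \<bar>f y - f x\<bar> < e"
    using agree_diff[OF x] by (intro exI[of _ m] ballI impI) (smt (verit))
qed

section \<open>Invariant integrals and bounds for Birkhoff sums\<close>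

lemma const_bernoulli: "(\<lambda>_. 1) \<in> bernoulli d"
  using d_pos by (simp add: bernoulli_def)

lemma f_bounded: obtains F where "\<And>x. x \<in> bernoulli d \<Longrightarrow> \<bar>f x\<bar> \<le> F"
proof
  fix x assume "x \<in> bernoulli d"
  then show "\<bar>f x\<bar> \<le> \<bar>f (\<lambda>_. 1)\<bar> + B * \<theta>"
    using agree_diff[OF _ const_bernoulli, of x 0] by auto
qed

text \<open>By invariance all \<open>f\<close> along the orbit have equal integral, so the left-hand
  side is the integral of the Birkhoff sum.\<close>

lemma integral_le_birkhoff:
  assumes \<nu>: "\<nu> \<in> invariant_probs \<X> shift"
    and s: "\<And>x. x \<in> bernoulli d \<Longrightarrow> birkhoff shift f n x \<le> s"
  shows "real n * (\<integral>x. f x \<partial>\<nu>) \<le> s"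
proof -
  have sets: "sets \<nu> = sets (borel_on \<X>)" and one: "emeasure \<nu> (space \<nu>) = 1"
    and shift: "shift \<in> measurable \<nu> \<nu>" and inv: "distr \<nu> \<nu> shift = \<nu>"
    using \<nu> by (auto simp: invariant_probs_def)
  have space: "space \<nu> = bernoulli d" using sets sets_eq_imp_space_eq space_borel by metis
  interpret finite_measure \<nu> by (rule finite_measureI) (simp add: one)
  have f: "f \<in> borel_measurable \<nu>"
    using borel_measurable_continuous_map[OF f_continuous] by (simp add: measurable_cong_sets[OF sets refl])
  have pow: "(shift ^^ i) \<in> measurable \<nu> \<nu>" for i
    by (induction i) (simp, simp only: funpow.simps, rule measurable_comp[OF _ shift])
  have meas: "(\<lambda>x. f ((shift ^^ i) x)) \<in> borel_measurable \<nu>" for i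
    using measurable_compose[OF pow f] .
  obtain F where F: "\<And>x. x \<in> bernoulli d \<Longrightarrow> \<bar>f x\<bar> \<le> F" by (rule f_bounded) blast
  have integ: "integrable \<nu> (\<lambda>x. f ((shift ^^ i) x))" for i
    by (rule integrable_const_bound[where B = F, OF _ meas])
      (auto intro!: AE_I2 F funpow_shift_bernoulli simp: space)
  have int: "(\<integral>x. f ((shift ^^ i) x) \<partial>\<nu>) = (\<integral>x. f x \<partial>\<nu>)" for i
  proof (induction i)
    case (Suc i)
    have "(\<integral>x. f ((shift ^^ i) x) \<partial>\<nu>) = (\<integral>x. f ((shift ^^ i) x) \<partial>distr \<nu> \<nu> shift)"
      by (simp add: inv)
    also have "\<dots> = (\<integral>x. f ((shift ^^ i) (shift x)) \<partial>\<nu>)"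
      by (rule integral_distr[OF shift meas])
    finally show ?case using Suc.IH by (simp add: funpow_swap1)
  qed simp
  have "real n * (\<integral>x. f x \<partial>\<nu>) = (\<integral>x. birkhoff shift f n x \<partial>\<nu>)"
    unfolding birkhoff_def by (subst Bochner_Integration.integral_sum) (auto simp: integ int)
  also have "\<dots> \<le> (\<integral>x. s \<partial>\<nu>)"
    unfolding birkhoff_def
    by (rule integral_mono) (auto intro!: Bochner_Integration.integrable_sum integ simp: space s[unfolded birkhoff_def])
  also have "\<dots> = s" using one by (simp add: measure_def)
  finally show ?thesis .
qed

lemma orbit_measure:
  assumes x: "x \<in> Fix d n" and n: "1 \<le> n"
  obtains \<mu> where "\<mu> \<in> invariant_probs \<X> shift" "(\<integral>x. f x \<partial>\<mu>) = birkhoff shift f n x / real n"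
proof -
  have "(\<Sum>i<n. g (shift ((shift ^^ i) x))) = (\<Sum>i<n. g ((shift ^^ i) x) :: real)" for g
    using birkhoff_periodic[where T = shift and n = n and x = x and g = g] x by (simp add: Fix_def birkhoff_def funpow_swap1)
  then have "\<exists>\<mu>. \<mu> \<in> invariant_probs \<X> shift \<and>
      (\<forall>g. continuous_map \<X> euclideanreal g \<longrightarrow> (\<integral>x. g x \<partial>\<mu>) = (\<Sum>i<n. 1 / real n * g ((shift ^^ i) x)))"
    using n x
    by - (rule finitely_supported_invariant[of "{..<n}" "\<lambda>_. 1 / real n" "\<lambda>i. (shift ^^ i) x"],
      auto simp: funpow_shift_bernoulli Fix_bernoulli simp flip: sum_distrib_left sum_divide_distrib)
  then show ?thesis
    using f_continuous by (auto intro!: that simp: birkhoff_def sum_divide_distrib)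
qed

lemma bdd_above_integrals: "bdd_above ((\<lambda>\<nu>. \<integral>x. f x \<partial>\<nu>) ` invariant_probs \<X> shift)"
proof -
  obtain F where F: "\<And>x. x \<in> bernoulli d \<Longrightarrow> \<bar>f x\<bar> \<le> F" by (rule f_bounded) blast
  have "(\<integral>x. f x \<partial>\<nu>) \<le> F" if "\<nu> \<in> invariant_probs \<X> shift" for \<nu>
    using integral_le_birkhoff[OF that, of 1 F] F by (force simp: birkhoff_Suc)
  then show ?thesis by (rule bdd_aboveI2)
qed

text \<open>The orbit measure competes in the supremum that defines \<open>\<beta>\<close>. So no
  periodic orbit has a negative loss.\<close>

lemma birkhoff_Fix_le:
  assumes x: "x \<in> Fix d n"
  shows "birkhoff shift f n x \<le> real n * \<beta>"
proof (cases "n = 0")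
  case False
  then obtain \<mu> where \<mu>: "\<mu> \<in> invariant_probs \<X> shift" "(\<integral>x. f x \<partial>\<mu>) = birkhoff shift f n x / real n"
    using orbit_measure[OF x] by auto
  have "birkhoff shift f n x / real n \<le> \<beta>"
    unfolding beta_def \<mu>(2)[symmetric] by (rule cSUP_upper[OF \<mu>(1) bdd_above_integrals])
  then show ?thesis using False by (simp add: field_simps)
qed simp

text \<open>If all Birkhoff sums of length \<open>n\<close> were at most \<open>s\<close>, every
  invariant integral would be at most \<open>s / n\<close>, and so would
  \<open>\<beta>\<close>.\<close>

lemma exists_birkhoff_gt:
  assumes "s < real n * \<beta>"
  obtains x where "x \<in> bernoulli d" "s < birkhoff shift f n x"
proof (rule ccontr)
  assume "\<not> thesis"
  then have le: "birkhoff shift f n x \<le> s" if "x \<in> bernoulli d" for x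
    using that by (meson linorder_not_less \<open>\<And>x. \<lbrakk>x \<in> bernoulli d; s < birkhoff shift f n x\<rbrakk> \<Longrightarrow> thesis\<close>)
  show False
  proof (cases "n = 0")
    case True
    then show False using le[OF const_bernoulli] assms by simp
  next
    case False
    \<comment> \<open>A fixed point of the shift shows that the supremum is over a nonempty
      set.\<close>
    have "(\<lambda>_. 1) \<in> Fix d 1" using const_bernoulli by (simp add: Fix_def shift_def)
    then obtain \<mu> where "\<mu> \<in> invariant_probs \<X> shift" using orbit_measure by blast
    then have ne: "invariant_probs \<X> shift \<noteq> {}" by blast
    have "\<beta> \<le> s / real n"
      unfolding beta_def
    proof (rule cSUP_least[OF ne])
      fix \<nu> assume "\<nu> \<in> invariant_probs \<X> shift"
      from integral_le_birkhoff[OF this le] show "(\<integral>x. f x \<partial>\<nu>) \<le> s / real n"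
        using False by (simp add: field_simps)
    qed
    then show False using False assms by (simp add: field_simps)
  qed
qed

text \<open>Closing up the first \<open>n\<close> letters gives a periodic point whose sum differs
  by at most \<open>K\<close>.\<close>

lemma birkhoff_le:
  assumes "x \<in> bernoulli d"
  shows "birkhoff shift f n x \<le> real n * \<beta> + K"
proof -
  have "\<bar>birkhoff shift f n x - birkhoff shift f n (periodize n x)\<bar> \<le> K * \<theta> ^ 0"
    by (rule birkhoff_distortion[OF assms Fix_bernoulli[OF periodize_Fix[OF assms]]])
      (simp add: periodize_def)
  then show ?thesis using birkhoff_Fix_le[OF periodize_Fix[OF assms, of n]] by simp
qed

text \<open>The block of length \<open>p\<close> at position \<open>i\<close> is cut out:
  \<open>y\<close> is \<open>x\<close> without it and \<open>z\<close> repeats it forever. As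
  \<open>L\<close> letters recur after the block, \<open>x\<close> and \<open>y\<close> share
  \<open>i + L\<close> letters, and the block and \<open>z\<close> share \<open>p + L\<close>; each
  comparison costs \<open>K * \<theta> ^ L\<close>. Behind the cut the orbits of \<open>x\<close>
  and \<open>y\<close> coincide.\<close>

lemma birkhoff_cut_loop:
  assumes x: "x \<in> bernoulli d" and n: "i + p \<le> n"
    and loop: "\<forall>t<L. x (i + t) = x (i + p + t)"
  obtains y z where "y \<in> bernoulli d" "z \<in> Fix d p"
    "birkhoff shift f n x \<le> birkhoff shift f (n - p) y + birkhoff shift f p z + 2 * (K * \<theta> ^ L)"
proof
  define y where "y = (\<lambda>t. if t < i then x t else x (t + p))"
  define u where "u = (shift ^^ i) x"
  define z where "z = periodize p u"
  have u: "u \<in> bernoulli d" unfolding u_def by (rule funpow_shift_bernoulli[OF x])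
  show z: "z \<in> Fix d p" unfolding z_def by (rule periodize_Fix[OF u])
  show y: "y \<in> bernoulli d" using x by (simp add: y_def bernoulli_def)
  have ret: "u (t + p) = u t" if "t < L" for t
    using loop[rule_format, OF that] by (simp add: u_def funpow_shift add_ac)
  have "u t = u (t mod p)" if "t < p + L" for t
    using that
  proof (induction t rule: less_induct)
    case (less t)
    show ?case
    proof (cases "t < p \<or> p = 0")
      case False
      then have "t - p < L" "t - p + p = t" using less.prems by auto
      then have "u t = u (t - p)" using ret[of "t - p"] by simp
      also have "\<dots> = u ((t - p) mod p)" using less False by simp
      finally show ?thesis using False by (simp add: mod_if[of t])
    qed auto
  qed
  then have 1: "\<bar>birkhoff shift f p u - birkhoff shift f p z\<bar> \<le> K * \<theta> ^ L"
    by (intro birkhoff_distortion u Fix_bernoulli[OF z]) (simp add: z_def periodize_def)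
  have "x t = y t" if "t < i + L" for t
    using loop[rule_format, of "t - i"] that by (auto simp: y_def add_ac)
  then have 2: "\<bar>birkhoff shift f i x - birkhoff shift f i y\<bar> \<le> K * \<theta> ^ L"
    by (intro birkhoff_distortion x y) simp
  have tail: "(shift ^^ p) u = (shift ^^ i) y"
    by (simp add: fun_eq_iff u_def y_def funpow_shift add_ac)
  have "birkhoff shift f n x = birkhoff shift f (i + (p + (n - i - p))) x" using n by simp
  also have "\<dots> = birkhoff shift f i x + (birkhoff shift f p u + birkhoff shift f (n - i - p) ((shift ^^ i) y))"
    unfolding birkhoff_add tail[symmetric] u_def[symmetric] ..
  also have "birkhoff shift f (n - i - p) ((shift ^^ i) y) = birkhoff shift f (i + (n - i - p)) y - birkhoff shift f i y"
    unfolding birkhoff_add by simp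
  also have "i + (n - i - p) = n - p" using n by simp
  finally show "birkhoff shift f n x \<le> birkhoff shift f (n - p) y + birkhoff shift f p z + 2 * (K * \<theta> ^ L)"
    using 1 2 by linarith
qed

text \<open>Pigeonhole: there are \<open>d ^ L + 1\<close> starting positions but only
  \<open>d ^ L\<close> words of length \<open>L\<close>.\<close>

lemma exists_recurrence:
  assumes "x \<in> bernoulli d"
  obtains i p where "1 \<le> p" "i + p \<le> d ^ L" "\<forall>t<L. x (i + t) = x (i + p + t)"
proof -
  let ?w = "\<lambda>i. restrict (\<lambda>t. x (i + t)) {..<L}"
  have sub: "?w ` {..d ^ L} \<subseteq> ({..<L} \<rightarrow>\<^sub>E {1..d})"
    using assms by (simp add: bernoulli_def image_subset_iff restrict_PiE_iff)
  have "card (?w ` {..d ^ L}) \<le> card ({..<L} \<rightarrow>\<^sub>E {1..d})"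
    by (rule card_mono[OF _ sub]) (simp add: finite_PiE)
  also have "\<dots> < card {..d ^ L}" by (simp add: card_PiE)
  finally have "\<not> inj_on ?w {..d ^ L}" by (rule pigeonhole)
  then obtain i j where ij: "i < j" "j \<le> d ^ L" "?w i = ?w j"
    unfolding inj_on_def by (metis atMost_iff linorder_neqE_nat)
  show ?thesis
  proof (rule that[of "j - i" i])
    show "\<forall>t<L. x (i + t) = x (i + (j - i) + t)"
      using ij fun_cong[OF ij(3)] by (metis lessThan_iff le_add_diff_inverse less_imp_le restrict_apply')
  qed (use ij in auto)
qed

text \<open>Supplies the lower bound for the normalizing sum of \<open>periodic_measure\<close>. The
  proof assumes that every loop loses at least \<open>\<epsilon>\<close> and cuts loops until
  \<open>birkhoff_le\<close> contradicts the existence of nearly maximal segments.\<close>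

lemma exists_almost_maximizing_orbit:
  assumes "0 < \<epsilon>"
  obtains p z where "1 \<le> p" "z \<in> Fix d p" "real p * \<beta> - birkhoff shift f p z < \<epsilon>"
proof (rule ccontr)
  assume neg: "\<not> thesis"
  have loss: "birkhoff shift f p z \<le> real p * \<beta> - \<epsilon>" if "1 \<le> p" "z \<in> Fix d p" for p z
    using that neg by (smt (verit) \<open>\<And>z p. \<lbrakk>1 \<le> p; z \<in> Fix d p; real p * \<beta> - birkhoff shift f p z < \<epsilon>\<rbrakk> \<Longrightarrow> thesis\<close>)
  \<comment> \<open>\<open>L\<close> makes the two distortion errors of one cut at most
    \<open>\<epsilon> / 2\<close>; \<open>K + 1\<close> avoids division by zero.\<close>
  have "0 < \<epsilon> / (4 * (K + 1))" using assms K_nonneg by simp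
  then obtain L where L: "\<theta> ^ L < \<epsilon> / (4 * (K + 1))" using real_arch_pow_inv theta(2) by blast
  have "K * \<theta> ^ L \<le> (K + 1) * \<theta> ^ L" using theta by (intro mult_right_mono) auto
  also have "\<dots> \<le> \<epsilon> / 4" using L K_nonneg by (simp add: field_simps)
  finally have small: "2 * (K * \<theta> ^ L) \<le> \<epsilon> / 2" by simp
  \<comment> \<open>Induction on the number \<open>T\<close> of cuts. The first \<open>d ^ L\<close>
    steps contain a loop, whose loss exceeds the cutting error by at least
    \<open>\<epsilon> / 2\<close>; what remains still has length at least \<open>T * d ^ L\<close>
    for the next cuts.\<close>
  have main: "birkhoff shift f n x \<le> real n * \<beta> + K - real T * (\<epsilon> / 2)"
    if "T * d ^ L \<le> n" "x \<in> bernoulli d" for T n x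
    using that
  proof (induction T arbitrary: n x)
    case 0
    then show ?case using birkhoff_le by simp
  next
    case (Suc T)
    obtain i p where ip: "1 \<le> p" "i + p \<le> d ^ L" "\<forall>t<L. x (i + t) = x (i + p + t)"
      using exists_recurrence[OF Suc.prems(2)] by blast
    have n: "i + p \<le> n" "T * d ^ L \<le> n - p" using ip(2) Suc.prems(1) by auto
    obtain y z where yz: "y \<in> bernoulli d" "z \<in> Fix d p"
      "birkhoff shift f n x \<le> birkhoff shift f (n - p) y + birkhoff shift f p z + 2 * (K * \<theta> ^ L)"
      using birkhoff_cut_loop[OF Suc.prems(2) n(1) ip(3)] by blast
    have "real n * \<beta> = real (n - p) * \<beta> + real p * \<beta>"
      using n(1) by (simp add: of_nat_diff algebra_simps)
    moreover have "real (Suc T) * (\<epsilon> / 2) = real T * (\<epsilon> / 2) + \<epsilon> / 2"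
      by (simp add: algebra_simps)
    ultimately show ?case
      using yz(3) loss[OF ip(1) yz(2)] Suc.IH[OF n(2) yz(1)] small by linarith
  qed
  \<comment> \<open>\<open>T\<close> cuts outweigh the constant \<open>K\<close> of
    \<open>birkhoff_le\<close> together with the slack \<open>1\<close> of the nearly maximal
    segment chosen next.\<close>
  obtain T where T: "(K + 1) / (\<epsilon> / 2) < real T" using reals_Archimedean2 by blast
  then have T': "K + 1 < real T * (\<epsilon> / 2)" using assms by (simp add: pos_divide_less_eq)
  obtain x where "x \<in> bernoulli d" "real (T * d ^ L) * \<beta> - 1 < birkhoff shift f (T * d ^ L) x"
    using exists_birkhoff_gt[of "real (T * d ^ L) * \<beta> - 1" "T * d ^ L"] by auto
  then show False using main[of T "T * d ^ L" x] T' by simp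
qed

end

subsection \<open>Pressure and the deviation function\<close>

text \<open>Both \<open>pressure\<close> and \<open>dev_lim\<close> are limits of quantities that
  grow as the radius shrinks, hence suprema.\<close>

lemma antimono_tendsto_at_right:
  fixes h :: "real \<Rightarrow> ereal"
  assumes "\<And>\<epsilon> \<epsilon>'. 0 < \<epsilon> \<Longrightarrow> \<epsilon> \<le> \<epsilon>' \<Longrightarrow> h \<epsilon>' \<le> h \<epsilon>"
  shows "(h \<longlongrightarrow> (SUP \<epsilon>\<in>{0<..}. h \<epsilon>)) (at_right 0)"
proof (rule order_tendstoI)
  fix a assume "a < (SUP \<epsilon>\<in>{0<..}. h \<epsilon>)"
  then obtain \<epsilon> where "0 < \<epsilon>" "a < h \<epsilon>" by (auto simp: less_SUP_iff)
  then show "\<forall>\<^sub>F x in at_right 0. a < h x"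
    unfolding eventually_at_right_field using assms by (metis less_imp_le order_less_le_trans)
next
  fix a assume a: "(SUP \<epsilon>\<in>{0<..}. h \<epsilon>) < a"
  show "\<forall>\<^sub>F x in at_right 0. h x < a"
    unfolding eventually_at_right_field
    using a by (auto intro!: exI[of _ 1] intro: le_less_trans[OF SUP_upper])
qed

lemma antimono_Lim_at_right:
  fixes h :: "real \<Rightarrow> ereal"
  assumes "\<And>\<epsilon> \<epsilon>'. 0 < \<epsilon> \<Longrightarrow> \<epsilon> \<le> \<epsilon>' \<Longrightarrow> h \<epsilon>' \<le> h \<epsilon>"
  shows "Lim (at_right 0) h = (SUP \<epsilon>\<in>{0<..}. h \<epsilon>)"
  using antimono_tendsto_at_right[OF assms] by (intro tendsto_Lim) auto

lemma dev_lim_SUP: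
  "dev_lim d \<theta> f x = (SUP \<epsilon>\<in>{0<..}. INF y\<in>{y \<in> PER d. bdist \<theta> y x \<le> \<epsilon>}. ereal (dev d \<theta> f y))"
  unfolding dev_lim_def by (rule antimono_Lim_at_right) (auto intro!: INF_superset_mono)

text \<open>A periodic \<open>x\<close> is itself admissible at every radius, so
  \<open>dev_lim\<close> does not exceed \<open>dev\<close> there. Conversely, a small ball around
  any point of the cylinder stays inside it, so its periodic points already compete on the other
  side.\<close>

lemma INF_dev_lim:
  assumes "0 < \<theta>" "\<theta> < 1"
  shows "(INF x\<in>cylinder d a. dev_lim d \<theta> f x) = (INF x\<in>cylinder d a \<inter> PER d. ereal (dev d \<theta> f x))"
proof (rule antisym)
  show "(INF x\<in>cylinder d a. dev_lim d \<theta> f x) \<le> (INF x\<in>cylinder d a \<inter> PER d. ereal (dev d \<theta> f x))"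
  proof (rule INF_greatest)
    fix x assume x: "x \<in> cylinder d a \<inter> PER d"
    then have "(INF x\<in>cylinder d a. dev_lim d \<theta> f x) \<le> dev_lim d \<theta> f x" by (auto intro: INF_lower)
    also have "\<dots> \<le> ereal (dev d \<theta> f x)"
      unfolding dev_lim_SUP using x by (intro SUP_least INF_lower) auto
    finally show "(INF x\<in>cylinder d a. dev_lim d \<theta> f x) \<le> ereal (dev d \<theta> f x)" .
  qed
  show "(INF x\<in>cylinder d a \<inter> PER d. ereal (dev d \<theta> f x)) \<le> (INF x\<in>cylinder d a. dev_lim d \<theta> f x)"
  proof (rule INF_greatest)
    fix x assume x: "x \<in> cylinder d a"
    let ?\<epsilon> = "\<theta> ^ Suc (length a)"
    have "y \<in> cylinder d a" if "y \<in> PER d" "bdist \<theta> y x \<le> ?\<epsilon>" for y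
    proof -
      have "?\<epsilon> < \<theta> ^ length a" using assms by simp
      then have "\<forall>i<length a. y i = x i"
        using bdist_less_agree[OF assms, of y x "length a"] that(2) by force
      then show ?thesis using x that(1) by (auto simp: cylinder_def PER_def Fix_def)
    qed
    then have "(INF x\<in>cylinder d a \<inter> PER d. ereal (dev d \<theta> f x)) \<le>
        (INF y\<in>{y \<in> PER d. bdist \<theta> y x \<le> ?\<epsilon>}. ereal (dev d \<theta> f y))"
      by (intro INF_superset_mono) auto
    also have "\<dots> \<le> dev_lim d \<theta> f x"
      unfolding dev_lim_SUP using assms by (intro SUP_upper) auto
    finally show "(INF x\<in>cylinder d a \<inter> PER d. ereal (dev d \<theta> f x)) \<le> dev_lim d \<theta> f x" .
  qed
qed

section \<open>Separated sets and bounds for the pressure\<close>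

lemma separated_empty: "separated M T n \<epsilon> {}"
  by (simp add: separated_def)

lemma separated_antimono: "separated M T n \<epsilon>' E \<Longrightarrow> \<epsilon> \<le> \<epsilon>' \<Longrightarrow> separated M T n \<epsilon> E"
  unfolding separated_def by (meson order.strict_trans1)

context lipschitz_potential
begin

abbreviation "P c \<equiv> pressure (bernoulli_metric d \<theta>) shift (\<lambda>y. c * f y)"

text \<open>Points sharing \<open>n + m\<close> letters stay within \<open>\<theta> ^ m\<close> for
  \<open>n\<close> steps, so a separated set has at most one point per word of that length.\<close>

lemma separated_exp_sum_le:
  assumes c: "0 < c" and m: "\<theta> ^ m < \<epsilon>" and E: "separated (bernoulli_metric d \<theta>) shift n \<epsilon> E"
  shows "(\<Sum>x\<in>E. exp (birkhoff shift (\<lambda>y. c * f y) n x)) \<le> real d ^ (n + m) * exp (c * (real n * \<beta> + K))"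
proof -
  have EX: "E \<subseteq> bernoulli d" using E by (simp add: separated_def)
  have "x = y" if xy: "x \<in> E" "y \<in> E" "\<forall>i<n + m. x i = y i" for x y
  proof (rule ccontr)
    assume "x \<noteq> y"
    then obtain i where i: "i < n" "\<epsilon> < bdist \<theta> ((shift ^^ i) x) ((shift ^^ i) y)"
      using E xy(1,2) unfolding separated_def bernoulli_metric_simps[OF theta] by blast
    have "bdist \<theta> ((shift ^^ i) x) ((shift ^^ i) y) \<le> \<theta> ^ Suc m"
      using xy(3) i(1) by (intro bdist_le_of_agree[OF theta]) (auto simp: funpow_shift)
    also have "\<dots> \<le> \<theta> ^ m" using theta by (intro power_decreasing) auto
    finally show False using i(2) m by simp
  qed
  then have card: "card E \<le> d ^ (n + m)" using EX by (intro words_card(2)) auto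
  have "(\<Sum>x\<in>E. exp (birkhoff shift (\<lambda>y. c * f y) n x)) \<le> real (card E) * exp (c * (real n * \<beta> + K))"
    using c EX by (intro sum_bounded_above) (auto simp: birkhoff_mult_left birkhoff_le)
  also have "\<dots> \<le> real d ^ (n + m) * exp (c * (real n * \<beta> + K))"
    using card by (intro mult_right_mono) (simp_all flip: of_nat_power)
  finally show ?thesis .
qed

lemma bdd_above_separated:
  assumes c: "0 < c" and \<epsilon>: "0 < \<epsilon>"
  shows "bdd_above ((\<lambda>E. \<Sum>x\<in>E. exp (birkhoff shift (\<lambda>y. c * f y) n x)) `
    {E. separated (bernoulli_metric d \<theta>) shift n \<epsilon> E})"
proof -
  obtain m where "\<theta> ^ m < \<epsilon>" using real_arch_pow_inv[OF \<epsilon> theta(2)] by blast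
  from separated_exp_sum_le[OF c this] show ?thesis by (intro bdd_aboveI2) auto
qed

lemma separated_sum_ge:
  assumes c: "0 < c" and \<epsilon>: "0 < \<epsilon>" and x: "x \<in> bernoulli d"
  shows "exp (c * birkhoff shift f n x)
    \<le> separated_sum (bernoulli_metric d \<theta>) shift (\<lambda>y. c * f y) n \<epsilon>"
proof -
  have "separated (bernoulli_metric d \<theta>) shift n \<epsilon> {x}" using x by (simp add: separated_def)
  then have "(\<Sum>x\<in>{x}. exp (birkhoff shift (\<lambda>y. c * f y) n x))
      \<le> separated_sum (bernoulli_metric d \<theta>) shift (\<lambda>y. c * f y) n \<epsilon>"
    unfolding separated_sum_def by (intro cSUP_upper bdd_above_separated c \<epsilon>) auto
  then show ?thesis by (simp add: birkhoff_mult_left)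
qed

lemma separated_sum_pos:
  assumes "0 < c" "0 < \<epsilon>"
  shows "0 < separated_sum (bernoulli_metric d \<theta>) shift (\<lambda>y. c * f y) n \<epsilon>"
  by (rule less_le_trans[OF exp_gt_zero separated_sum_ge[OF assms const_bernoulli]])

lemma ln_separated_sum_ge:
  assumes c: "0 < c" and \<epsilon>: "0 < \<epsilon>"
  shows "c * (real n * \<beta>) \<le> ln (separated_sum (bernoulli_metric d \<theta>) shift (\<lambda>y. c * f y) n \<epsilon>)"
proof (rule field_le_epsilon)
  fix e :: real assume e: "0 < e"
  let ?S = "separated_sum (bernoulli_metric d \<theta>) shift (\<lambda>y. c * f y) n \<epsilon>"
  \<comment> \<open>The slack \<open>e / c\<close> becomes \<open>e\<close> after multiplication by
    \<open>c\<close>.\<close>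
  obtain x where x: "x \<in> bernoulli d" "real n * \<beta> - e / c < birkhoff shift f n x"
    using exists_birkhoff_gt[of "real n * \<beta> - e / c" n] c e by auto
  have "c * birkhoff shift f n x \<le> ln ?S"
    using separated_sum_ge[OF c \<epsilon> x(1), of n] separated_sum_pos[OF c \<epsilon>, of n] by (subst ln_ge_iff)
  moreover have "c * (real n * \<beta>) - e \<le> c * birkhoff shift f n x"
    using mult_left_mono[OF less_imp_le[OF x(2)], of c] c by (simp add: algebra_simps)
  ultimately show "c * (real n * \<beta>) \<le> ln ?S + e" by simp
qed

lemma ln_separated_sum_le:
  assumes c: "0 < c" and m: "\<theta> ^ m < \<epsilon>"
  shows "ln (separated_sum (bernoulli_metric d \<theta>) shift (\<lambda>y. c * f y) n \<epsilon>)
    \<le> real (n + m) * ln (real d) + c * (real n * \<beta> + K)"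
proof -
  let ?S = "separated_sum (bernoulli_metric d \<theta>) shift (\<lambda>y. c * f y) n \<epsilon>"
  have \<epsilon>: "0 < \<epsilon>" using m theta by (meson less_trans zero_less_power)
  have le: "?S \<le> real d ^ (n + m) * exp (c * (real n * \<beta> + K))"
    unfolding separated_sum_def
    using separated_exp_sum_le[OF c m] separated_empty by (intro cSUP_least) (auto intro!: exI[of _ "{}"])
  have "0 < ?S" by (rule separated_sum_pos[OF c \<epsilon>])
  then have "ln ?S \<le> ln (real d ^ (n + m) * exp (c * (real n * \<beta> + K)))"
    using le by simp
  also have "\<dots> = real (n + m) * ln (real d) + c * (real n * \<beta> + K)"
    using d_pos by (simp add: ln_mult ln_realpow)
  finally show ?thesis .
qed

text \<open>An excess of at most \<open>ln d\<close> over \<open>c * \<beta>\<close> is precise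
  enough: multiplied by a period up to \<open>N\<close>, it is negligible against
  \<open>c\<close>.\<close>

lemma pressure_bounds:
  assumes c: "0 < c"
  shows "c * \<beta> \<le> P c" "P c \<le> c * \<beta> + ln (real d)"
proof -
  define S where "S = separated_sum (bernoulli_metric d \<theta>) shift (\<lambda>y. c * f y)"
  define h where "h = (\<lambda>\<epsilon>. limsup (\<lambda>n. ereal (ln (S n \<epsilon>) / real n)))"
  have lower: "ereal (c * \<beta>) \<le> h \<epsilon>" if "0 < \<epsilon>" for \<epsilon>
    unfolding h_def
  proof (rule le_Limsup)
    show "\<forall>\<^sub>F n in sequentially. ereal (c * \<beta>) \<le> ereal (ln (S n \<epsilon>) / real n)"
      using eventually_gt_at_top[of 0]
      by eventually_elim (use ln_separated_sum_ge[OF c that] in \<open>auto simp: S_def field_simps\<close>)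
  qed simp
  have upper: "h \<epsilon> \<le> ereal (c * \<beta> + ln (real d))" if pos: "0 < \<epsilon>" for \<epsilon>
  proof -
    obtain m where m: "\<theta> ^ m < \<epsilon>" using real_arch_pow_inv[OF pos theta(2)] by blast
    \<comment> \<open>The contributions of the resolution \<open>m\<close> and the distortion
      \<open>K\<close> do not grow with \<open>n\<close> and vanish after division by
      \<open>n\<close>.\<close>
    let ?u = "\<lambda>n. (ln (real d) + c * \<beta>) + (real m * ln (real d) + c * K) / real n"
    have "h \<epsilon> \<le> limsup (\<lambda>n. ereal (?u n))"
      unfolding h_def
    proof (rule Limsup_mono)
      show "\<forall>\<^sub>F n in sequentially. ereal (ln (S n \<epsilon>) / real n) \<le> ereal (?u n)"
        using eventually_gt_at_top[of 0]
        by eventually_elim (use ln_separated_sum_le[OF c m] in \<open>auto simp: S_def field_simps\<close>)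
    qed
    also have "?u \<longlonglongrightarrow> (ln (real d) + c * \<beta>) + 0"
      by (intro tendsto_intros lim_const_over_n)
    then have "limsup (\<lambda>n. ereal (?u n)) = ereal (ln (real d) + c * \<beta>)"
      by (intro lim_imp_Limsup) simp_all
    finally show ?thesis by (simp add: add.commute)
  qed
  have "h \<epsilon>' \<le> h \<epsilon>" if "0 < \<epsilon>" "\<epsilon> \<le> \<epsilon>'" for \<epsilon> \<epsilon>'
    unfolding h_def
  proof (intro Limsup_mono always_eventually allI)
    fix n
    have "S n \<epsilon>' \<le> S n \<epsilon>"
      unfolding S_def separated_sum_def
      using that separated_empty
      by (intro cSUP_subset_mono bdd_above_separated c) (auto intro: separated_antimono intro!: exI[of _ "{}"])
    moreover have "0 < S n \<epsilon>'"
      unfolding S_def using that by (intro separated_sum_pos c) auto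
    ultimately show "ereal (ln (S n \<epsilon>') / real n) \<le> ereal (ln (S n \<epsilon>) / real n)"
      by (simp add: divide_right_mono)
  qed
  then have eq: "P c = real_of_ereal (SUP \<epsilon>\<in>{0<..}. h \<epsilon>)"
    unfolding pressure_def S_def[symmetric] h_def[symmetric] by (simp add: antimono_Lim_at_right)
  have "ereal (c * \<beta>) \<le> (SUP \<epsilon>\<in>{0<..}. h \<epsilon>)"
    by (rule SUP_upper2[of 1]) (auto intro: lower)
  moreover have "(SUP \<epsilon>\<in>{0<..}. h \<epsilon>) \<le> ereal (c * \<beta> + ln (real d))"
    by (rule SUP_least) (simp add: upper)
  \<comment> \<open>The supremum is finite by the two bounds, so \<open>real_of_ereal\<close>
    returns its actual value.\<close>
  ultimately show "c * \<beta> \<le> P c" "P c \<le> c * \<beta> + ln (real d)"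
    unfolding eq by (cases "SUP \<epsilon>\<in>{0<..}. h \<epsilon>"; simp)+
qed

end

subsection \<open>Periodic measures\<close>

lemma cylinder_PER_nonempty:
  assumes "1 \<le> d" "set a \<subseteq> {1..d}"
  shows "cylinder d a \<inter> PER d \<noteq> {}"
proof -
  \<comment> \<open>The word is padded by the letter \<open>1\<close> and repeated with period
    \<open>length a + 1\<close>, which is positive even for the empty word.\<close>
  define x where "x = (\<lambda>i. if i < length a then a ! i else 1)"
  have x: "x \<in> bernoulli d"
    using assms nth_mem by (fastforce simp: x_def bernoulli_def)
  have "periodize (Suc (length a)) x \<in> PER d"
    using periodize_Fix[OF x, of "Suc (length a)"] by (auto simp: PER_def)
  moreover have "periodize (Suc (length a)) x \<in> cylinder d a"
    using Fix_bernoulli[OF periodize_Fix[OF x, of "Suc (length a)"]]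
    by (simp add: cylinder_def periodize_def x_def)
  ultimately show ?thesis by blast
qed

context lipschitz_potential
begin

lemma weight_shift:
  assumes "x \<in> Fix d n"
  shows "weight d \<theta> f c n (shift x) = weight d \<theta> f c n x"
  using birkhoff_periodic[where T = shift and n = n and x = x and g = f] assms
  by (simp add: weight_def Fix_def)

text \<open>The unnormalized value of \<open>periodic_measure\<close> on \<open>k\<close>; a point
  counts once for each of its periods up to \<open>N\<close>, minimal or not.\<close>

definition mass :: "real \<Rightarrow> nat \<Rightarrow> (nat \<Rightarrow> nat) set \<Rightarrow> real" where
  "mass c N k = (\<Sum>n=1..N. \<Sum>x\<in>Fix d n. weight d \<theta> f c n x * indicat_real k x)"

lemma mass_total: "mass c N (bernoulli d) = (\<Sum>n=1..N. \<Sum>x\<in>Fix d n. weight d \<theta> f c n x)"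
  unfolding mass_def by (intro sum.cong) (auto simp: Fix_bernoulli)

lemma weight_le_mass:
  assumes "1 \<le> p" "p \<le> N" "z \<in> Fix d p" "z \<in> k"
  shows "weight d \<theta> f c p z \<le> mass c N k"
proof -
  have "weight d \<theta> f c p z \<le> (\<Sum>x\<in>Fix d p. weight d \<theta> f c p x * indicat_real k x)"
    using member_le_sum[of z "Fix d p" "\<lambda>x. weight d \<theta> f c p x * indicat_real k x"] assms
    by (simp add: finite_Fix weight_def)
  also have "\<dots> \<le> mass c N k"
    unfolding mass_def using assms
    by (intro member_le_sum[of p "{1..N}"]) (auto intro!: sum_nonneg simp: weight_def)
  finally show ?thesis .
qed

lemma mass_pos:
  assumes "1 \<le> p" "p \<le> N" "z \<in> Fix d p" "z \<in> k"
  shows "0 < mass c N k"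
  using weight_le_mass[OF assms, of c] by (auto simp: weight_def intro: less_le_trans[OF exp_gt_zero])

text \<open>The measure with atoms indexed by pairs \<open>(n, x)\<close> has the required
  integrals, and \<open>measure_eqI_continuous\<close> makes it the only one. Testing it on the
  indicator of the cylinder gives the quotient.\<close>

lemma measure_periodic_measure:
  assumes N: "1 \<le> N"
  shows "measure (periodic_measure d \<theta> f c N) (cylinder d a) = mass c N (cylinder d a) / mass c N (bernoulli d)"
proof -
  let ?Z = "mass c N (bernoulli d)"
  let ?w = "\<lambda>(n, x). weight d \<theta> f c n x / ?Z"
  let ?A = "Sigma {1..N} (Fix d)"
  let ?R = "\<lambda>g. (\<Sum>n=1..N. \<Sum>x\<in>Fix d n. weight d \<theta> f c n x * (birkhoff shift g n x / real n)) /
             (\<Sum>n=1..N. \<Sum>x\<in>Fix d n. weight d \<theta> f c n x)"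
  have Z: "0 < ?Z"
    using const_bernoulli N by (intro mass_pos[of 1 _ "\<lambda>_. 1"]) (auto simp: Fix_def shift_def)
  have R: "?R g = (\<Sum>n=1..N. \<Sum>x\<in>Fix d n. weight d \<theta> f c n x * g x) / ?Z" for g
    unfolding mass_total
    by (intro arg_cong2[where f = "(/)"] sum.cong sum_Fix_birkhoff refl weight_shift) auto
  have sumA: "(\<Sum>p\<in>?A. ?w p * g (snd p)) = (\<Sum>n=1..N. \<Sum>x\<in>Fix d n. weight d \<theta> f c n x * g x) / ?Z"
    for g :: "_ \<Rightarrow> real"
    unfolding sum_divide_distrib by (subst sum.Sigma) (auto simp: finite_Fix intro!: sum.cong)
  obtain \<mu> where \<mu>: "\<mu> \<in> invariant_probs \<X> shift"
    "\<And>g. continuous_map \<X> euclideanreal g \<Longrightarrow> (\<integral>x. g x \<partial>\<mu>) = (\<Sum>p\<in>?A. ?w p * g (snd p))"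
  proof (rule finitely_supported_invariant[of ?A ?w snd])
    show "finite ?A" by (auto simp: finite_Fix)
    show "0 \<le> ?w p" for p using Z by (auto simp: weight_def split: prod.split)
    show "snd p \<in> bernoulli d" if "p \<in> ?A" for p using that Fix_bernoulli by auto
    show "(\<Sum>p\<in>?A. ?w p) = 1" using sumA[of "\<lambda>_. 1"] Z by (simp add: mass_total)
    fix g :: "_ \<Rightarrow> real"
    have "(\<Sum>x\<in>Fix d n. weight d \<theta> f c n x * g (shift x)) = (\<Sum>x\<in>Fix d n. weight d \<theta> f c n x * g x)"
      if "1 \<le> n" for n
      using sum_Fix_shift[OF that, where d = d and g = "\<lambda>x. weight d \<theta> f c n x * g x"]
      by (simp add: weight_shift cong: sum.cong_simp)
    then show "(\<Sum>p\<in>?A. ?w p * g (shift (snd p))) = (\<Sum>p\<in>?A. ?w p * g (snd p))"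
      unfolding sumA[of g] sumA[of "\<lambda>x. g (shift x)"] by simp
  qed blast
  let ?Q = "\<lambda>\<mu>. \<mu> \<in> invariant_probs \<X> shift \<and>
        (\<forall>g. continuous_map \<X> euclideanreal g \<longrightarrow> (\<integral>x. g x \<partial>\<mu>) = ?R g)"
  have "(\<integral>x. g x \<partial>\<mu>) = ?R g" if "continuous_map \<X> euclideanreal g" for g
    using \<mu>(2)[OF that] unfolding R sumA .
  then have "?Q \<mu>" using \<mu>(1) by blast
  moreover have "\<nu> = \<mu>" if "?Q \<nu>" for \<nu>
    using that \<open>?Q \<mu>\<close> by (intro measure_eqI_continuous) (auto simp: invariant_probs_def)
  ultimately have "periodic_measure d \<theta> f c N = \<mu>"
    unfolding periodic_measure_def by (rule the_equality)
  moreover have "measure \<mu> (cylinder d a) = mass c N (cylinder d a) / ?Z"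
  proof -
    have "sets \<mu> = sets (borel_on \<X>)" using \<mu>(1) by (simp add: invariant_probs_def)
    then have "space \<mu> = bernoulli d" using sets_eq_imp_space_eq space_borel by metis
    then have "cylinder d a \<inter> space \<mu> = cylinder d a" using cylinder_subset by blast
    then show ?thesis
      using \<mu>(2)[OF continuous_map_indicator_cylinder[of a]] unfolding sumA mass_def[symmetric] by simp
  qed
  ultimately show ?thesis by simp
qed

text \<open>Separates the loss, which determines the exponential rate, from the pressure excess,
  which lies between \<open>0\<close> and \<open>ln d\<close> per step.\<close>

lemma weight_eq:
  "weight d \<theta> f c n x = exp (- c * (real n * \<beta> - birkhoff shift f n x) - real n * (P c - c * \<beta>))"
  by (simp add: weight_def algebra_simps)

section \<open>Two-sided estimates of masses and the limit\<close>

lemma ln_d_nonneg: "0 \<le> ln (real d)"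
  using d_pos by simp

lemma mass_ge:
  assumes c: "0 < c" and "1 \<le> p" "p \<le> N" "z \<in> Fix d p" "z \<in> k"
  shows "- c * (real p * \<beta> - birkhoff shift f p z) - real N * ln (real d) \<le> ln (mass c N k)"
proof -
  have "real p * (P c - c * \<beta>) \<le> real N * ln (real d)"
    using pressure_bounds[OF c] assms by (intro mult_mono) auto
  then have "exp (- c * (real p * \<beta> - birkhoff shift f p z) - real N * ln (real d)) \<le> weight d \<theta> f c p z"
    unfolding weight_eq by simp
  also have "\<dots> \<le> mass c N k" using assms by (intro weight_le_mass)
  finally show ?thesis using mass_pos[OF assms(2-)] by (subst ln_ge_iff)
qed

lemma mass_le:
  assumes c: "0 < c" and pos: "0 < mass c N k"
    and J: "\<And>n x. 1 \<le> n \<Longrightarrow> x \<in> Fix d n \<Longrightarrow> x \<in> k \<Longrightarrow> J \<le> real n * \<beta> - birkhoff shift f n x"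
  shows "ln (mass c N k) \<le> - c * J + real N * (1 + ln (real d))"
proof -
  have "mass c N k \<le> (\<Sum>n=1..N. real d ^ N * exp (- c * J))"
    unfolding mass_def
  proof (rule sum_mono)
    fix n assume n: "n \<in> {1..N}"
    have "(\<Sum>x\<in>Fix d n. weight d \<theta> f c n x * indicat_real k x) \<le> real (card (Fix d n)) * exp (- c * J)"
    proof (rule sum_bounded_above)
      fix x assume x: "x \<in> Fix d n"
      show "weight d \<theta> f c n x * indicat_real k x \<le> exp (- c * J)"
      proof (cases "x \<in> k")
        case True
        then have "c * J \<le> c * (real n * \<beta> - birkhoff shift f n x)"
          using J[of n x] n x c by (intro mult_left_mono) auto
        moreover have "0 \<le> real n * (P c - c * \<beta>)" using pressure_bounds(1)[OF c] by simp
        ultimately have "weight d \<theta> f c n x \<le> exp (- c * J)" unfolding weight_eq by simp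
        then show ?thesis using True by simp
      qed simp
    qed
    also have "real (card (Fix d n)) \<le> real d ^ n"
      using card_Fix[of n d] n by (simp flip: of_nat_power)
    also have "real d ^ n \<le> real d ^ N" using n d_pos by (intro power_increasing) auto
    finally show "(\<Sum>x\<in>Fix d n. weight d \<theta> f c n x * indicat_real k x) \<le> real d ^ N * exp (- c * J)"
      by simp
  qed
  also have "\<dots> = real N * (real d ^ N * exp (- c * J))" by simp
  \<comment> \<open>The number of periods is absorbed into an exponential, so that the error in the
    exponent is linear in \<open>N\<close>.\<close>
  also have "\<dots> \<le> exp (real N) * (real d ^ N * exp (- c * J))"
  proof (rule mult_right_mono)
    show "real N \<le> exp (real N)" using exp_ge_add_one_self[of "real N"] by linarith
  qed simp
  also have "\<dots> = exp (- c * J + real N * (1 + ln (real d)))"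
    using d_pos by (simp add: exp_add ring_distribs exp_diff exp_minus exp_of_nat_mult divide_inverse)
  finally have "ln (mass c N k) \<le> ln (exp (- c * J + real N * (1 + ln (real d))))"
    using pos by (intro ln_mono) auto
  then show ?thesis by simp
qed

text \<open>The surplus \<open>n - min_period x\<close> is again a period (possibly
  \<open>0\<close>), and its loss is nonnegative. Hence counting points at non-minimal periods does
  not lower the minimal loss.\<close>

lemma dev_le_loss:
  assumes n: "1 \<le> n" and x: "x \<in> Fix d n"
  shows "dev d \<theta> f x \<le> real n * \<beta> - birkhoff shift f n x"
proof -
  let ?m = "min_period x"
  have "x \<in> PER d" using assms by (auto simp: PER_def)
  then have m: "x \<in> Fix d ?m" by (rule min_period)
  have le: "?m \<le> n" using min_period_le[OF assms] .
  have mx: "(shift ^^ ?m) x = x" using m by (simp add: Fix_def)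
  have "(shift ^^ (n - ?m)) x = (shift ^^ (n - ?m)) ((shift ^^ ?m) x)" by (simp add: mx)
  also have "\<dots> = (shift ^^ (n - ?m + ?m)) x" by (simp add: funpow_add)
  also have "\<dots> = x" using le x by (simp add: Fix_def)
  finally have "x \<in> Fix d (n - ?m)" using x by (simp add: Fix_def)
  from birkhoff_Fix_le[OF this]
  have "birkhoff shift f (n - ?m) x \<le> real n * \<beta> - real ?m * \<beta>"
    using le by (simp add: of_nat_diff algebra_simps)
  moreover have "birkhoff shift f n x = birkhoff shift f ?m x + birkhoff shift f (n - ?m) x"
    using birkhoff_add[of shift f ?m "n - ?m" x] le mx by simp
  ultimately show ?thesis by (simp add: dev_def)
qed

lemma dev_nonneg: "x \<in> PER d \<Longrightarrow> 0 \<le> dev d \<theta> f x"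
  using birkhoff_Fix_le[OF min_period(2)] by (simp add: dev_def)

lemma tendsto_ln_periodic_measure:
  assumes a: "set a \<subseteq> {1..d}"
  defines "k \<equiv> cylinder d a"
  shows "((\<lambda>(c, N). 1 / c * ln (measure (periodic_measure d \<theta> f c N) k))
      \<longlongrightarrow> - (INF x\<in>k \<inter> PER d. dev d \<theta> f x))
    (inf (at_top \<times>\<^sub>F sequentially) (filtercomap (\<lambda>(c, N). real N / c) (nhds 0)))"
    (is "(?r \<longlongrightarrow> - ?J) ?F")
proof (rule tendstoI)
  fix e :: real assume e: "0 < e"
  \<comment> \<open>The error per unit of \<open>N\<close> in a quotient of masses:
    \<open>ln d\<close> from the lower bound of one mass plus \<open>1 + ln d\<close> from the upper
    bound of the other. It receives half of \<open>e\<close>; the choice of \<open>x\<close> or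
    \<open>z\<close> uses the other half.\<close>
  define Q where "Q = 1 + 2 * ln (real d)"
  have Q: "0 < Q" using ln_d_nonneg by (simp add: Q_def)
  have ne: "k \<inter> PER d \<noteq> {}" unfolding k_def by (rule cylinder_PER_nonempty[OF d_pos a])
  have bdd: "bdd_below (dev d \<theta> f ` (k \<inter> PER d))"
    using dev_nonneg by (intro bdd_belowI2[of _ 0]) auto
  obtain x where x: "x \<in> k" "x \<in> PER d" "dev d \<theta> f x < ?J + e / 2"
    using cINF_less_iff[OF ne bdd, of "?J + e / 2"] e by auto
  \<comment> \<open>While \<open>x\<close> bounds the mass of \<open>k\<close> from below,
    \<open>z\<close> does so for the total mass, at almost no loss.\<close>
  obtain p z where z: "1 \<le> p" "z \<in> Fix d p" "real p * \<beta> - birkhoff shift f p z < e / 2"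
    using exists_almost_maximizing_orbit[of "e / 2"] e by auto
  have J: "?J \<le> real n * \<beta> - birkhoff shift f n y" if "1 \<le> n" "y \<in> Fix d n" "y \<in> k" for n y
  proof -
    have "y \<in> k \<inter> PER d" using that by (auto simp: PER_def)
    then have "?J \<le> dev d \<theta> f y" by (rule cINF_lower[OF bdd])
    then show ?thesis using dev_le_loss[OF that(1,2)] by simp
  qed
  \<comment> \<open>The bound on \<open>N\<close> ensures that \<open>x\<close> and \<open>z\<close>
    both occur in the sums, at their periods \<open>min_period x\<close> and
    \<open>p\<close>.\<close>
  have main: "dist (?r (c, N)) (- ?J) < e"
    if c: "0 < c" and N: "max p (min_period x) \<le> N" and q: "dist (real N / c) 0 < e / (2 * Q)" for c N
  proof -
    have Ne: "real N * Q < c * (e / 2)"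
      using q c Q by (simp add: dist_real_def field_simps)
    have x': "1 \<le> min_period x" "min_period x \<le> N" "x \<in> Fix d (min_period x)" "x \<in> bernoulli d"
      using min_period[OF x(2)] N Fix_bernoulli by auto
    have z': "p \<le> N" "z \<in> bernoulli d" using N z(2) Fix_bernoulli by auto
    have pos: "0 < mass c N k" "0 < mass c N (bernoulli d)"
      using mass_pos[OF x'(1-3)] x(1) x'(4) by blast+
    have "?r (c, N) = (ln (mass c N k) - ln (mass c N (bernoulli d))) / c"
      using measure_periodic_measure[of N c a] pos z(1) z'(1) by (simp add: k_def ln_div)
    moreover have "- c * dev d \<theta> f x - real N * ln (real d) \<le> ln (mass c N k)"
      using mass_ge[OF c x'(1-3) x(1)] by (simp add: dev_def)
    moreover have "ln (mass c N k) \<le> - c * ?J + real N * (1 + ln (real d))"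
      by (rule mass_le[OF c pos(1) J])
    moreover have "ln (mass c N (bernoulli d)) \<le> - c * 0 + real N * (1 + ln (real d))"
      by (rule mass_le[OF c pos(2)]) (simp add: birkhoff_Fix_le)
    moreover have "- c * (e / 2) - real N * ln (real d) \<le> ln (mass c N (bernoulli d))"
    proof -
      have "c * (real p * \<beta> - birkhoff shift f p z) \<le> c * (e / 2)"
        using c z(3) by (intro mult_left_mono) auto
      then show ?thesis using mass_ge[OF c z(1) z'(1) z(2) z'(2)] by simp
    qed
    moreover have "c * dev d \<theta> f x < c * (?J + e / 2)" using c x(3) by simp
    moreover have "c * (e / 2) + c * (e / 2) = c * e" by simp
    moreover have "real N * Q = real N * ln (real d) + real N * (1 + ln (real d))"
      by (simp add: Q_def algebra_simps)
    ultimately have "?r (c, N) = (ln (mass c N k) - ln (mass c N (bernoulli d))) / c"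
      "ln (mass c N k) - ln (mass c N (bernoulli d)) < c * (- ?J + e)"
      "c * (- ?J - e) < ln (mass c N k) - ln (mass c N (bernoulli d))"
      using Ne unfolding distrib_left right_diff_distrib by simp_all
    then show ?thesis using c by (simp add: dist_real_def abs_less_iff field_simps)
  qed
  have "\<forall>\<^sub>F (c, N) in at_top \<times>\<^sub>F sequentially. (0::real) < c \<and> max p (min_period x) \<le> N"
    unfolding case_prod_unfold by (intro eventually_prodI eventually_gt_at_top eventually_ge_at_top)
  then have "\<forall>\<^sub>F (c, N) in ?F. 0 < c \<and> max p (min_period x) \<le> N"
    by (rule filter_leD[OF inf_le1])
  moreover have "\<forall>\<^sub>F u in nhds (0::real). dist u 0 < e / (2 * Q)"
    unfolding eventually_nhds_metric using e Q by (intro exI[of _ "e / (2 * Q)"]) simp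
  then have "\<forall>\<^sub>F (c, N) in ?F. dist (real N / c) 0 < e / (2 * Q)"
    by (intro filter_leD[OF inf_le2]) (auto intro: eventually_filtercomapI simp: eventually_filtercomap)
  ultimately show "\<forall>\<^sub>F q in ?F. dist (?r q) (- ?J) < e"
    by eventually_elim (use main in auto)
qed

end

theorem theorem24:
  fixes d :: nat and \<theta> :: real and f :: "(nat \<Rightarrow> nat) \<Rightarrow> real" and k :: "(nat \<Rightarrow> nat) set"
  assumes "1 \<le> d" and "0 < \<theta>" and "\<theta> < 1"
    and "Lipschitz_continuous_map (bernoulli_metric d \<theta>) euclidean_metric f"
    and "k \<in> cylinders d"
  shows "((\<lambda>(c, N). ereal (1 / c * ln (measure (periodic_measure d \<theta> f c N) k)))
            \<longlongrightarrow> - (INF x \<in> k \<inter> PER d. ereal (dev d \<theta> f x)))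
           (inf (at_top \<times>\<^sub>F sequentially)
                (filtercomap (\<lambda>(c, N). real N / c) (nhds 0)))
         \<and> - (INF x \<in> k \<inter> PER d. ereal (dev d \<theta> f x)) = - (INF x \<in> k. dev_lim d \<theta> f x)"
proof -
  obtain a where a: "k = cylinder d a" "set a \<subseteq> {1..d}" using assms(5) by (auto simp: cylinders_def)
  obtain B where "0 < B" "\<And>x y. x \<in> bernoulli d \<Longrightarrow> y \<in> bernoulli d \<Longrightarrow> \<bar>f x - f y\<bar> \<le> B * bdist \<theta> x y"
    using assms(4) unfolding Lipschitz_continuous_map_pos bernoulli_metric_simps[OF assms(2,3)]
    by (auto simp: dist_real_def)
  then interpret lipschitz_potential d \<theta> f B
    using assms(1-3) by unfold_locales auto
  \<comment> \<open>A nonempty set of reals bounded below has the same infimum in the extended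
    reals, which transfers the real limit.\<close>
  have "bdd_below (dev d \<theta> f ` (k \<inter> PER d))"
    using dev_nonneg by (intro bdd_belowI2[of _ 0]) auto
  then have "ereal (INF x\<in>k \<inter> PER d. dev d \<theta> f x) = (INF x\<in>k \<inter> PER d. ereal (dev d \<theta> f x))"
    using ereal_Inf'[of "dev d \<theta> f ` (k \<inter> PER d)"] cylinder_PER_nonempty[OF assms(1) a(2)]
    by (simp add: image_image a(1))
  then have "- (INF x\<in>k \<inter> PER d. ereal (dev d \<theta> f x)) = ereal (- (INF x\<in>k \<inter> PER d. dev d \<theta> f x))"
    by (metis uminus_ereal.simps(1))
  moreover have "((\<lambda>(c, N). ereal (1 / c * ln (measure (periodic_measure d \<theta> f c N) k)))
      \<longlongrightarrow> ereal (- (INF x\<in>k \<inter> PER d. dev d \<theta> f x)))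
    (inf (at_top \<times>\<^sub>F sequentially) (filtercomap (\<lambda>(c, N). real N / c) (nhds 0)))"
    using tendsto_ereal[OF tendsto_ln_periodic_measure[OF a(2)]]
    unfolding a(1) prod.case_distrib[of ereal] .
  ultimately show ?thesis
    using INF_dev_lim[OF assms(2,3), where d = d and a = a and f = f] by (simp only: a(1) simp_thms)
qed

end
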